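(* Let $\{p(\tau)\}_{\tau\in\mathbb{N}_0}$ be a probability distribution on $\mathbb{N}_0$, let $T$ be a random variable with $\mathbb{P}(T=\tau)=p(\tau)$ for $\tau\in\mathbb{N}_0$, and let $\{(X,T)_t\}_{t\ge 0}$ be the trapped random walk with trapping time distribution $p$, started at the origin, i.e. $\mathbb{P}((X,T)_0=(z,\tau))=p(\tau)$ if $z=0$ and $=0$ otherwise. Assume that $\mathbb{E}(T^\alpha)<\infty$ for some $\alpha\in(1,2]$ and define $C_T:=\mathbb{E}(|T-\mathbb{E}(T)|^\alpha)$ and $\mu:=\mathbb{E}(T)+1$. For each $C>8\,C_T/\mu+\sqrt{2\mu/\pi}$ there exists $t^*=t^*(C)\in\mathbb{N}$ such that for each bounded interval $I\subset\mathbb{R}$ and each $t\geq t^*$, $$\left|\mathbb{P}\left(X_t\in\sqrt{\frac{t}{\mu}}\,I\right)-\frac{1}{\sqrt{2\pi}}\int_I e^{-x^2/2}\,dx\right|\leq C\,t^{\frac{1-\alpha}{1+\alpha}}.$$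
   Context: $\mathbb{N}_0=\{0,1,2,\dots\}$; for $c>0$ and $I\subset\mathbb{R}$, $c\,I=\{cx: x\in I\}$. Trapped random walk with trapping time distribution $p$: the discrete-time Markov chain $(X,T)_t=(X_t,T_t)$ on $\mathbb{Z}\times\mathbb{N}_0$ with transition probabilities $$\mathbb{P}((X,T)_{t+1}=(z',\tau')\mid (X,T)_t=(z,\tau))=\begin{cases}p(\tau')/2 & \text{if } |z-z'|=1 \text{ and } \tau=0,\\ 1 & \text{if } z=z' \text{ and } \tau'=\tau-1\geq 0,\\ 0&\text{otherwise.}\end{cases}$$ $X_t$ is the position and $T_t$ the remaining trapping time; $T$ without subscript denotes a generic trapping time with law $p$. *)

theory Defs
  imports "HOL-Probability.Probability"
begin

text \<open>
  Time-homogeneous discrete-time Markov chains on a countable state space, given by transition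
  probabilities \<open>q s s'\<close>. The conditional law of the next state is prescribed given every
  history of positive probability, so this comprises both the Markov property and the one-step
  transition probabilities.
\<close>

definition markov_chain ::
    "'a measure \<Rightarrow> ('s::countable \<Rightarrow> 's \<Rightarrow> real) \<Rightarrow> (nat \<Rightarrow> 'a \<Rightarrow> 's) \<Rightarrow> bool" where
  "markov_chain M q Z \<longleftrightarrow>
     prob_space M \<and>
     (\<forall>t. Z t \<in> measurable M (count_space UNIV)) \<and>
     (\<forall>t s s'. \<P>(\<omega> in M. \<forall>i\<le>t. Z i \<omega> = s i) > 0 \<longrightarrow>
        \<P>(\<omega> in M. Z (Suc t) \<omega> = s' \<bar> \<forall>i\<le>t. Z i \<omega> = s i) = q (s t) s')"

definition trapped_transition :: "nat pmf \<Rightarrow> int \<times> nat \<Rightarrow> int \<times> nat \<Rightarrow> real" where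
  "trapped_transition p = (\<lambda>(z, \<tau>) (z', \<tau>').
     if \<bar>z - z'\<bar> = 1 \<and> \<tau> = 0 then pmf p \<tau>' / 2
     else if z = z' \<and> \<tau> \<ge> 1 \<and> \<tau>' = \<tau> - 1 then 1
     else 0)"

definition trapped_random_walk ::
    "'a measure \<Rightarrow> nat pmf \<Rightarrow> (nat \<Rightarrow> 'a \<Rightarrow> int) \<Rightarrow> (nat \<Rightarrow> 'a \<Rightarrow> nat) \<Rightarrow> bool" where
  "trapped_random_walk M p X R \<longleftrightarrow>
     markov_chain M (trapped_transition p) (\<lambda>t \<omega>. (X t \<omega>, R t \<omega>))"

definition started_at_origin ::
    "'a measure \<Rightarrow> nat pmf \<Rightarrow> (nat \<Rightarrow> 'a \<Rightarrow> int) \<Rightarrow> (nat \<Rightarrow> 'a \<Rightarrow> nat) \<Rightarrow> bool" where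
  "started_at_origin M p X R \<longleftrightarrow>
     (\<forall>z \<tau>. \<P>(\<omega> in M. (X 0 \<omega>, R 0 \<omega>) = (z, \<tau>)) = (if z = 0 then pmf p \<tau> else 0))"

end

theory Submission
  imports Defs
begin

text \<open>
  The position is \<open>X t = S (K t)\<close>, where \<open>S\<close> is a simple random walk and \<open>K t\<close>, the number of jumps
  up to time \<open>t\<close>, is an independent renewal counting process. The event \<open>K t \<ge> k\<close> says that a sum of
  \<open>k\<close> independent copies of \<open>T + 1\<close> is at most \<open>t\<close>, so a von Bahr--Esseen moment bound shows that
  \<open>K t\<close> deviates from \<open>n = t / \<mu>\<close> by more than about \<open>n \<epsilon>\<close> with probability at most
  \<open>(8 C\<^sub>T / \<mu>) \<epsilon> (1 + o(1))\<close>, where \<open>\<epsilon> = t powr ((1 - \<alpha>) / (1 + \<alpha>))\<close>. For every other value \<open>k\<close>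
  of \<open>K t\<close> the law of \<open>S k\<close> is within \<open>O(1 / sqrt k)\<close> of a Gaussian by Stein's method, and replacing
  the variance \<open>k\<close> by \<open>n\<close> costs at most \<open>sqrt (2 / pi) \<epsilon>\<close> up to lower order terms. Since
  \<open>(\<alpha> - 1) / (1 + \<alpha>) \<le> 1 / 3\<close>, the Stein error is of lower order, and \<open>\<mu> \<ge> 1\<close> gives the claim.
\<close>

subsection \<open>Simple random walk\<close>

text \<open>Recursing on the first step makes the starting point an argument. The walk arises in
  this form when the trapped chain is conditioned on its first jump.\<close>

primrec srw :: "nat \<Rightarrow> int \<Rightarrow> int pmf" where
  "srw 0 z = return_pmf z"
| "srw (Suc n) z = bind_pmf (pmf_of_set {z - 1, z + 1}) (srw n)"

declare srw.simps(2) [simp del]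

lemma finite_set_srw [simp]: "finite (set_pmf (srw n z))"
  by (induction n arbitrary: z) (auto simp: srw.simps(2))

lemma integrable_srw [simp]:
  fixes f :: "int \<Rightarrow> real"
  shows "integrable (measure_pmf (srw n z)) f"
  by (simp add: integrable_measure_pmf_finite)

abbreviation srw_exp :: "nat \<Rightarrow> int \<Rightarrow> (int \<Rightarrow> real) \<Rightarrow> real" where
  "srw_exp n z f \<equiv> measure_pmf.expectation (srw n z) f"

lemma srw_exp_first_step:
  "srw_exp (Suc n) z f = (srw_exp n (z - 1) f + srw_exp n (z + 1) f) / 2"
  by (simp add: srw.simps(2) pmf_expectation_bind_pmf_of_set add_divide_distrib)

text \<open>Splitting off the last step keeps the start fixed, so inductions can stay at the start
  0, where the weight \<open>of_int s\<close> is centred.\<close>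

lemma srw_exp_last_step:
  "srw_exp (Suc n) z f = srw_exp n z (\<lambda>s. (f (s - 1) + f (s + 1)) / 2)"
proof (induction n arbitrary: z)
  case (Suc n)
  show ?case
    by (simp only: Suc.IH srw_exp_first_step[of "Suc n" z] srw_exp_first_step[of n z])
qed (simp add: srw_exp_first_step)

text \<open>A discrete Stein identity: it characterises the walk in the same way in which
  \<open>E (Z f Z) = E (f' Z)\<close> characterises the standard normal distribution.\<close>

lemma srw_stein:
  "srw_exp n 0 (\<lambda>s. of_int s * (f (s + 1) + f (s - 1))) = real n * srw_exp n 0 (\<lambda>s. f (s + 1) - f (s - 1))"
proof (induction n arbitrary: f)
  case (Suc n)
  define g where "g s = (f (s + 1) + f (s - 1)) / 2" for s
  define d where "d s = f (s + 1) - f (s - 1)" for s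
  \<comment> \<open>Averaging over the last step replaces \<open>f\<close> by its neighbour mean
    \<open>g\<close>; the change of the weight from \<open>s\<close> to \<open>s + 1\<close> or
    \<open>s - 1\<close> leaves one extra difference of \<open>g\<close>, which raises the factor
    \<open>n\<close> to \<open>Suc n\<close>.\<close>
  have "srw_exp (Suc n) 0 (\<lambda>s. of_int s * (f (s + 1) + f (s - 1)))
      = srw_exp n 0 (\<lambda>s. of_int s * (g (s + 1) + g (s - 1)) + (g (s + 1) - g (s - 1)))"
    unfolding srw_exp_last_step by (rule Bochner_Integration.integral_cong) (simp_all add: g_def field_simps)
  also have "\<dots> = srw_exp n 0 (\<lambda>s. of_int s * (g (s + 1) + g (s - 1))) + srw_exp n 0 (\<lambda>s. g (s + 1) - g (s - 1))"
    by (rule Bochner_Integration.integral_add) simp_all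
  also have "\<dots> = real (Suc n) * srw_exp n 0 (\<lambda>s. g (s + 1) - g (s - 1))"
    unfolding Suc.IH by (simp only: of_nat_Suc ring_distribs mult_1)
  also have "\<dots> = real (Suc n) * srw_exp (Suc n) 0 (\<lambda>s. f (s + 1) - f (s - 1))"
    unfolding srw_exp_last_step
    by (intro arg_cong2[of _ _ _ _ "(*)"] Bochner_Integration.integral_cong) (simp_all add: g_def field_simps)
  finally show ?case .
qed simp

lemma srw_second_moment: "srw_exp n 0 (\<lambda>s. (of_int s)\<^sup>2) = real n"
proof -
  have "srw_exp n 0 (\<lambda>s. 2 * (of_int s)\<^sup>2) = real n * srw_exp n 0 (\<lambda>s. 2)"
    using srw_stein[of n of_int] by (simp add: power2_eq_square algebra_simps)
  thus ?thesis by simp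
qed

lemma srw_abs_moment:
  assumes "n > 0"
  shows "srw_exp n 0 (\<lambda>s. \<bar>of_int s\<bar>) \<le> sqrt n"
proof -
  let ?r = "sqrt (real n)"
  have r: "?r > 0" "?r * ?r = n" using assms by auto
  have "srw_exp n 0 (\<lambda>s. \<bar>of_int s\<bar>) \<le> srw_exp n 0 (\<lambda>s. (of_int s)\<^sup>2 * (1 / (2 * ?r)) + ?r / 2)"
  proof (rule integral_mono)
    fix s :: int
    \<comment> \<open>The arithmetic-geometric mean inequality with weight \<open>sqrt n\<close>
      does the work of Cauchy-Schwarz.\<close>
    have "0 \<le> (\<bar>real_of_int s\<bar> - ?r)\<^sup>2" by simp
    hence "2 * ?r * \<bar>real_of_int s\<bar> \<le> (real_of_int s)\<^sup>2 + ?r * ?r"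
      by (simp add: power2_diff power2_eq_square algebra_simps)
    thus "\<bar>real_of_int s\<bar> \<le> (of_int s)\<^sup>2 * (1 / (2 * ?r)) + ?r / 2"
      using r(1) by (simp add: field_simps power2_eq_square)
  qed simp_all
  also have "\<dots> = srw_exp n 0 (\<lambda>s. (of_int s)\<^sup>2) * (1 / (2 * ?r)) + ?r / 2"
    by (subst Bochner_Integration.integral_add) simp_all
  also have "\<dots> = ?r"
    using r by (simp add: srw_second_moment field_simps)
  finally show ?thesis .
qed

text \<open>The Stein identity is applied to a clipped linear function: its central difference is 2
  on the window and nonnegative elsewhere, while the other side is at most four times the first
  absolute moment.\<close>

lemma srw_concentration:
  fixes a :: real
  assumes "n > 0"
  shows "measure_pmf.prob (srw n 0) {s. \<bar>of_int s - a\<bar> \<le> 1} \<le> 2 / sqrt n"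
proof -
  \<comment> \<open>Clipping at distance 2 leaves \<open>f\<close> linear at both neighbours of
    every point of the window.\<close>
  define f where "f s = max (- 2) (min 2 (of_int s - a))" for s :: int
  let ?A = "{s::int. \<bar>of_int s - a\<bar> \<le> 1}"
  have "2 * real n * measure_pmf.prob (srw n 0) ?A = real n * srw_exp n 0 (\<lambda>s. 2 * indicator ?A s)"
    by simp
  also have "\<dots> \<le> real n * srw_exp n 0 (\<lambda>s. f (s + 1) - f (s - 1))"
    by (intro mult_left_mono integral_mono) (auto simp: f_def indicator_def)
  also have "\<dots> = srw_exp n 0 (\<lambda>s. of_int s * (f (s + 1) + f (s - 1)))"
    by (rule srw_stein [symmetric])
  also have "\<dots> \<le> srw_exp n 0 (\<lambda>s. 4 * \<bar>of_int s\<bar>)"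
  proof (rule integral_mono)
    fix s :: int
    have "of_int s * (f (s + 1) + f (s - 1)) \<le> \<bar>of_int s\<bar> * \<bar>f (s + 1) + f (s - 1)\<bar>"
      by (metis abs_ge_self abs_mult)
    also have "\<dots> \<le> \<bar>of_int s\<bar> * 4"
      by (intro mult_left_mono) (auto simp: f_def)
    finally show "of_int s * (f (s + 1) + f (s - 1)) \<le> 4 * \<bar>of_int s\<bar>" by simp
  qed simp_all
  also have "\<dots> \<le> 4 * sqrt n"
    using srw_abs_moment[OF assms] by simp
  finally have "real n * measure_pmf.prob (srw n 0) ?A \<le> 2 * sqrt n" by simp
  hence "sqrt n * (sqrt n * measure_pmf.prob (srw n 0) ?A) \<le> sqrt n * 2"
    by (simp add: mult.assoc [symmetric] mult.commute)
  thus ?thesis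
    using assms by (simp add: pos_le_divide_eq mult.commute)
qed

subsection \<open>The standard normal distribution\<close>

abbreviation \<Phi> :: "real \<Rightarrow> real" where
  "\<Phi> \<equiv> cdf std_normal_distribution"

interpretation std_normal: real_distribution std_normal_distribution
  by (rule real_dist_normal_dist)

lemma integrable_std_normal_density: "integrable lborel std_normal_density"
  using integrable_std_normal_moment[of 0] by simp

lemma measure_std_normal:
  assumes "A \<in> sets borel"
  shows "measure std_normal_distribution A = (LINT x:A|lborel. std_normal_density x)"
proof -
  have "measure std_normal_distribution A = (LINT x|std_normal_distribution. indicator A x)"
    using assms by simp
  also have "\<dots> = (LINT x:A|lborel. std_normal_density x)"
    using assms by (subst integral_density) (auto simp: set_lebesgue_integral_def mult.commute)
  finally show ?thesis .
qed

lemma measure_std_normal_singleton: "measure std_normal_distribution {x} = 0"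
proof -
  have "AE y in lborel. indicator {x} y *\<^sub>R std_normal_density y = 0"
    using AE_lborel_singleton[of x] by eventually_elim simp
  thus ?thesis
    by (simp add: measure_std_normal set_lebesgue_integral_def integral_eq_zero_AE)
qed

lemma measure_std_normal_lessThan: "measure std_normal_distribution {..<x} = \<Phi> x"
proof -
  have "{..x} = {..<x} \<union> {x}" by auto
  hence "\<Phi> x = measure std_normal_distribution {..<x} + measure std_normal_distribution {x}"
    unfolding cdf_def by (simp only:) (rule std_normal.finite_measure_Union; simp)
  thus ?thesis by (simp add: measure_std_normal_singleton)
qed

lemma std_normal_density_gt_0: "std_normal_density x > 0"
  by (simp add: std_normal_density_def)

lemma std_normal_density_even: "std_normal_density (- x) = std_normal_density x"
  by (simp add: std_normal_density_def)

lemma DERIV_std_normal_density: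
  "(std_normal_density has_real_derivative - x * std_normal_density x) (at x)"
proof -
  have "((\<lambda>x. exp (- x\<^sup>2 / 2)) has_real_derivative - x * exp (- x\<^sup>2 / 2)) (at x)"
    by (auto intro!: derivative_eq_intros)
  from DERIV_cmult[OF this, of "1 / sqrt (2 * pi)"] show ?thesis
    unfolding std_normal_density_def by (simp only: mult.left_commute)
qed

text \<open>On a neighbourhood of \<open>x\<close> the distribution function is a constant plus the
  integral of the continuous density from \<open>x - 1\<close>, so the fundamental theorem of
  calculus applies.\<close>

lemma DERIV_\<Phi>: "(\<Phi> has_real_derivative std_normal_density x) (at x)"
proof -
  have cont: "continuous_on {x - 1..x + 1} std_normal_density"
    by (intro continuous_at_imp_continuous_on ballI DERIV_isCont[OF DERIV_std_normal_density])
  have eq: "\<Phi> u = \<Phi> (x - 1) + integral {x - 1..u} std_normal_density" if "u \<in> {x - 1..x + 1}" for u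
  proof (cases "u = x - 1")
    case False
    with that have "\<Phi> u - \<Phi> (x - 1) = measure std_normal_distribution {x - 1<..u}"
      by (intro std_normal.cdf_diff_eq) auto
    also have "\<dots> = (LINT y:{x - 1<..u}|lborel. std_normal_density y)"
      by (rule measure_std_normal) simp
    also have "\<dots> = integral {x - 1<..u} std_normal_density"
      using integrable_mult_indicator[OF _ integrable_std_normal_density]
      by (intro set_borel_integral_eq_integral) (simp only: set_integrable_def sets_lborel greaterThanAtMost_borel)
    also have "\<dots> = integral {x - 1..u} std_normal_density"
    proof (rule integral_subset_negligible)
      have "{x - 1..u} - {x - 1<..u} \<subseteq> {x - 1}" by auto
      thus "negligible ({x - 1..u} - {x - 1<..u})" by (rule negligible_subset[rotated]) simp
    qed auto
    finally show ?thesis by linarith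
  next
    case True
    show ?thesis unfolding True by simp
  qed
  have "((\<lambda>u. \<Phi> (x - 1) + integral {x - 1..u} std_normal_density) has_real_derivative std_normal_density x)
          (at x within {x - 1..x + 1})"
    by (auto intro!: derivative_eq_intros integral_has_real_derivative cont)
  hence "(\<Phi> has_real_derivative std_normal_density x) (at x within {x - 1..x + 1})"
    by (rule has_field_derivative_transform_within[of _ _ _ _ 1]) (assumption | rule eq[symmetric] | simp)+
  moreover have "x \<in> interior {x - 1..x + 1}" by simp
  ultimately show ?thesis by (metis at_within_interior)
qed

text \<open>The sum of \<open>\<Phi> x\<close> and \<open>\<Phi> (- x)\<close> has derivative zero
  because the density is even, and it tends to 1 at infinity.\<close>

lemma \<Phi>_uminus: "\<Phi> (- x) = 1 - \<Phi> x"
proof -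
  let ?f = "\<lambda>x. \<Phi> x + \<Phi> (- x)"
  have "\<forall>x. (?f has_real_derivative 0) (at x)"
    by (auto intro!: derivative_eq_intros DERIV_\<Phi> DERIV_chain2[of \<Phi>] simp: std_normal_density_even)
  hence "?f y = ?f x" for y by (rule DERIV_isconst_all)
  hence "(?f \<longlongrightarrow> ?f x) at_top" by (simp add: tendsto_eventually)
  moreover have "(?f \<longlongrightarrow> 1 + 0) at_top"
    by (intro tendsto_add std_normal.cdf_lim_at_top_prob
          filterlim_compose[OF std_normal.cdf_lim_at_bot] filterlim_uminus_at_bot_at_top)
  ultimately have "?f x = 1 + 0" by (intro tendsto_unique[of at_top]) auto
  thus ?thesis by simp
qed

text \<open>The gap between \<open>std_normal_density x / x\<close> and the upper tail has
  derivative \<open>- std_normal_density x / x\<^sup>2\<close> and vanishes at infinity, so it is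
  positive.\<close>

lemma mills_bound:
  assumes "x > 0"
  shows "x * (1 - \<Phi> x) \<le> std_normal_density x"
proof -
  let ?h = "\<lambda>x. std_normal_density x / x - (1 - \<Phi> x)"
  have "0 < ?h x"
  proof (rule DERIV_neg_imp_decreasing_at_top[of x ?h])
    fix y assume "y \<ge> x"
    hence y: "y > 0" using assms by simp
    have "(?h has_real_derivative - std_normal_density y / y\<^sup>2) (at y)"
      using y by (auto intro!: derivative_eq_intros DERIV_\<Phi> DERIV_std_normal_density
                       simp: field_simps power2_eq_square)
    thus "\<exists>d. (?h has_real_derivative d) (at y) \<and> d < 0"
      using y std_normal_density_gt_0[of y] by (intro exI conjI) auto
  next
    have "((\<lambda>x. (1 / sqrt (2 * pi)) * exp (- x\<^sup>2 / 2) / x) \<longlongrightarrow> 0) at_top"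
      by real_asymp
    hence "((\<lambda>x. std_normal_density x / x) \<longlongrightarrow> 0) at_top" by (simp add: std_normal_density_def)
    thus "(?h \<longlongrightarrow> 0) at_top"
      using tendsto_diff[OF _ tendsto_diff[OF tendsto_const std_normal.cdf_lim_at_top_prob, of 1]] by force
  qed
  thus ?thesis using assms by (simp add: field_simps)
qed

text \<open>This is \<open>stein_sol x x\<close>, the value of the Stein solution at its corner. It
  dominates \<open>stein_sol a x\<close> for every \<open>a\<close>, so one function controls all
  solutions.\<close>

definition normal_ratio :: "real \<Rightarrow> real" where
  "normal_ratio x = \<Phi> x * (1 - \<Phi> x) / std_normal_density x"

lemma normal_ratio_nonneg: "normal_ratio x \<ge> 0"
  using std_normal.cdf_nonneg[of x] std_normal.cdf_bounded_prob[of x]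
  by (simp add: normal_ratio_def)

lemma normal_ratio_even: "normal_ratio (- x) = normal_ratio x"
  by (simp add: normal_ratio_def \<Phi>_uminus std_normal_density_even)

lemma abs_mult_normal_ratio_le: "\<bar>x\<bar> * normal_ratio x \<le> 1"
proof -
  have *: "x * normal_ratio x \<le> 1" if "x > 0" for x
  proof -
    have "\<Phi> x * (x * (1 - \<Phi> x)) \<le> 1 * std_normal_density x"
      using that std_normal.cdf_nonneg[of x] std_normal.cdf_bounded_prob[of x]
      by (intro mult_mono mills_bound) auto
    thus ?thesis
      using std_normal_density_gt_0[of x] by (simp add: normal_ratio_def field_simps)
  qed
  show ?thesis
    using *[of x] *[of "- x"] by (cases x "0::real" rule: linorder_cases) (auto simp: normal_ratio_even)
qed

lemma normal_ratio_le: "normal_ratio x \<le> 9"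
\<comment> \<open>Far from the origin the bound on \<open>\<bar>x\<bar> * normal_ratio x\<close>
  suffices; near it the density is bounded below.\<close>
proof (cases "\<bar>x\<bar> \<ge> 1")
  case True
  have "normal_ratio x * 1 \<le> normal_ratio x * \<bar>x\<bar>"
    by (intro mult_left_mono True normal_ratio_nonneg)
  thus ?thesis using abs_mult_normal_ratio_le[of x] by (simp add: mult.commute)
next
  case False
  hence "x\<^sup>2 \<le> 1" by (simp add: abs_square_le_1)
  have "\<Phi> x * (1 - \<Phi> x) \<le> 1 * 1"
    using std_normal.cdf_nonneg[of x] std_normal.cdf_bounded_prob[of x]
    by (intro mult_mono) auto
  hence "normal_ratio x \<le> 1 / std_normal_density x"
    unfolding normal_ratio_def using std_normal_density_gt_0[of x] by (intro divide_right_mono) auto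
  also have "\<dots> = sqrt (2 * pi) * exp (x\<^sup>2 / 2)"
    by (simp add: std_normal_density_def exp_minus field_simps)
  \<comment> \<open>Crude constants: \<open>2 * pi\<close> is below 9, and the exponent is at most
    1.\<close>
  also have "\<dots> \<le> sqrt (3\<^sup>2) * exp 1"
    using \<open>x\<^sup>2 \<le> 1\<close> pi_less_4 by (intro mult_mono real_sqrt_le_mono) auto
  also have "\<dots> \<le> 3 * 3"
    by (intro mult_mono) (auto simp: exp_le)
  finally show ?thesis by simp
qed

lemma mult_exp_neg_half_square_le: "y * exp (- y\<^sup>2 / 2) \<le> (1 :: real)"
proof -
  have "y \<le> 1 + y\<^sup>2 / 2"
    using zero_le_power2[of "y - 1"] by (simp add: power2_eq_square algebra_simps)
  also have "\<dots> \<le> exp (y\<^sup>2 / 2)" by (rule exp_ge_add_one_self)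
  finally show ?thesis by (simp add: exp_minus field_simps)
qed

text \<open>The mean value theorem yields \<open>(r - 1) * x\<close> times the density at some
  \<open>z > x\<close>. The Gaussian decay at \<open>z\<close> absorbs the factor \<open>x\<close>,
  which makes the bound uniform in \<open>x\<close>.\<close>

lemma \<Phi>_scale_pos:
  assumes "x > 0" "1 \<le> r"
  shows "\<bar>\<Phi> (r * x) - \<Phi> x\<bar> \<le> (r - 1) / sqrt (2 * pi)"
proof -
  have "\<exists>z>x. z < r * x \<and> \<Phi> (r * x) - \<Phi> x = (r * x - x) * std_normal_density z" if "r > 1"
    using assms that by (intro MVT2 DERIV_\<Phi>) auto
  moreover have "\<bar>(r * x - x) * std_normal_density z\<bar> \<le> (r - 1) / sqrt (2 * pi)" if "z > x" for z
  proof -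
    have "(r * x - x) * std_normal_density z = (r - 1) / sqrt (2 * pi) * (x * exp (- z\<^sup>2 / 2))"
      by (simp add: std_normal_density_def algebra_simps diff_divide_distrib)
    moreover have "x * exp (- z\<^sup>2 / 2) \<le> z * exp (- z\<^sup>2 / 2)"
      using that by (intro mult_right_mono) auto
    hence "x * exp (- z\<^sup>2 / 2) \<le> 1" using mult_exp_neg_half_square_le[of z] by linarith
    ultimately show ?thesis
      using assms mult_left_le[of "x * exp (- z\<^sup>2 / 2)" "(r - 1) / sqrt (2 * pi)"]
      by (auto simp: abs_mult)
  qed
  ultimately show ?thesis using assms by (cases "r = 1") force+
qed

lemma \<Phi>_scale:
  assumes "1 \<le> r"
  shows "\<bar>\<Phi> (r * x) - \<Phi> x\<bar> \<le> (r - 1) / sqrt (2 * pi)"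
proof (cases x "0::real" rule: linorder_cases)
  case less
  thus ?thesis using \<Phi>_scale_pos[of "- x" r] assms by (simp add: \<Phi>_uminus abs_minus_commute)
qed (use \<Phi>_scale_pos assms in auto)

subsection \<open>Stein's method for the simple random walk\<close>

text \<open>The bounded solution of Stein's equation \<open>g' x - x * g x = indicator {..a} x - \<Phi> a\<close>;
  it has a corner at \<open>a\<close>, where \<open>stein_deriv\<close> is the left derivative.\<close>

definition stein_sol :: "real \<Rightarrow> real \<Rightarrow> real" where
  "stein_sol a x = (if x \<le> a then \<Phi> x * (1 - \<Phi> a) / std_normal_density x
                    else \<Phi> a * (1 - \<Phi> x) / std_normal_density x)"

definition stein_deriv :: "real \<Rightarrow> real \<Rightarrow> real" where
  "stein_deriv a x = x * stein_sol a x + (indicator {..a} x - \<Phi> a)"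

lemma stein_sol_nonneg: "stein_sol a x \<ge> 0"
  by (simp add: stein_sol_def std_normal.cdf_nonneg std_normal.cdf_bounded_prob)

lemma stein_sol_le_normal_ratio: "stein_sol a x \<le> normal_ratio x"
  unfolding stein_sol_def normal_ratio_def
  by (auto intro!: divide_right_mono mult_left_mono mult_right_mono std_normal.cdf_nondecreasing
           simp: std_normal.cdf_nonneg std_normal.cdf_bounded_prob)

lemma abs_stein_sol_le: "\<bar>stein_sol a x\<bar> \<le> 9"
  using stein_sol_nonneg[of a x] stein_sol_le_normal_ratio[of a x] normal_ratio_le[of x] by linarith

lemma abs_mult_stein_sol_le: "\<bar>x * stein_sol a x\<bar> \<le> 1"
proof -
  have "\<bar>x * stein_sol a x\<bar> \<le> \<bar>x\<bar> * normal_ratio x"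
    using stein_sol_nonneg[of a x] stein_sol_le_normal_ratio[of a x]
    by (simp add: abs_mult mult_left_mono)
  thus ?thesis using abs_mult_normal_ratio_le[of x] by linarith
qed

lemma abs_stein_deriv_le: "\<bar>stein_deriv a x\<bar> \<le> 2"
  using abs_mult_stein_sol_le[of x a] std_normal.cdf_nonneg[of a] std_normal.cdf_bounded_prob[of a]
  unfolding stein_deriv_def by (auto simp: indicator_def abs_le_iff)

lemma DERIV_stein_left:
  "((\<lambda>x. \<Phi> x * c / std_normal_density x) has_real_derivative
     x * (\<Phi> x * c / std_normal_density x) + c) (at x)"
  using std_normal_density_gt_0[of x]
  by (auto intro!: derivative_eq_intros DERIV_\<Phi> DERIV_std_normal_density simp: field_simps)

lemma DERIV_stein_right:
  "((\<lambda>x. c * (1 - \<Phi> x) / std_normal_density x) has_real_derivative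
     x * (c * (1 - \<Phi> x) / std_normal_density x) - c) (at x)"
  using std_normal_density_gt_0[of x]
  by (auto intro!: derivative_eq_intros DERIV_\<Phi> DERIV_std_normal_density simp: field_simps)

text \<open>The hypothesis keeps the interval on one side of the corner, where the solution is one
  of two smooth branches and Stein's equation supplies the derivative.\<close>

lemma stein_sol_mvt:
  assumes "x < y" "y \<le> a \<or> a \<le> x"
  shows "\<exists>\<xi>>x. \<xi> < y \<and> stein_sol a y - stein_sol a x = (y - x) * stein_deriv a \<xi>"
  using assms(2)
proof
  assume "y \<le> a"
  have "\<exists>\<xi>>x. \<xi> < y \<and> \<Phi> y * (1 - \<Phi> a) / std_normal_density y - \<Phi> x * (1 - \<Phi> a) / std_normal_density x
      = (y - x) * (\<xi> * (\<Phi> \<xi> * (1 - \<Phi> a) / std_normal_density \<xi>) + (1 - \<Phi> a))"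
    using assms(1) by (rule MVT2) (rule DERIV_stein_left)
  thus ?thesis
    using \<open>y \<le> a\<close> assms(1) unfolding stein_sol_def stein_deriv_def by fastforce
next
  assume "a \<le> x"
  \<comment> \<open>Both branches agree at \<open>a\<close>, so the right-hand formula also holds
    there.\<close>
  have *: "stein_sol a z = \<Phi> a * (1 - \<Phi> z) / std_normal_density z" if "z \<ge> a" for z
    using that by (auto simp: stein_sol_def)
  have "\<exists>\<xi>>x. \<xi> < y \<and> \<Phi> a * (1 - \<Phi> y) / std_normal_density y - \<Phi> a * (1 - \<Phi> x) / std_normal_density x
      = (y - x) * (\<xi> * (\<Phi> a * (1 - \<Phi> \<xi>) / std_normal_density \<xi>) - \<Phi> a)"
    using assms(1) by (rule MVT2) (rule DERIV_stein_right)
  then obtain \<xi> where \<xi>: "\<xi> > x" "\<xi> < y" "\<Phi> a * (1 - \<Phi> y) / std_normal_density y - \<Phi> a * (1 - \<Phi> x) / std_normal_density x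
      = (y - x) * (\<xi> * (\<Phi> a * (1 - \<Phi> \<xi>) / std_normal_density \<xi>) - \<Phi> a)" by blast
  show ?thesis
    using \<xi> \<open>a \<le> x\<close> assms(1) by (intro exI[of _ \<xi>]) (simp add: * stein_deriv_def)
qed

lemma stein_sol_lipschitz: "\<bar>stein_sol a y - stein_sol a x\<bar> \<le> 2 * \<bar>y - x\<bar>"
proof -
  have *: "\<bar>stein_sol a y - stein_sol a x\<bar> \<le> 2 * (y - x)" if xy: "x < y" "y \<le> a \<or> a \<le> x" for x y
  proof -
    obtain \<xi> where "stein_sol a y - stein_sol a x = (y - x) * stein_deriv a \<xi>"
      using stein_sol_mvt[OF xy] by blast
    thus ?thesis using mult_left_mono[OF abs_stein_deriv_le[of a \<xi>], of "y - x"] xy(1)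
      by (simp add: abs_mult)
  qed
  have **: "\<bar>stein_sol a y - stein_sol a x\<bar> \<le> 2 * (y - x)" if "x < y" for x y
  \<comment> \<open>An interval containing the corner in its interior is cut there.\<close>
  proof (cases "y \<le> a \<or> a \<le> x")
    case False
    hence "\<bar>stein_sol a a - stein_sol a x\<bar> \<le> 2 * (a - x)" "\<bar>stein_sol a y - stein_sol a a\<bar> \<le> 2 * (y - a)"
      by (intro *; simp)+
    thus ?thesis
      using abs_triangle_ineq[of "stein_sol a y - stein_sol a a" "stein_sol a a - stein_sol a x"] by simp
  qed (use * that in blast)
  show ?thesis
    using **[of x y] **[of y x] by (cases x y rule: linorder_cases) auto
qed

text \<open>Away from the corner the quotient equals the derivative at a nearby point, and by
  Stein's equation the derivative varies there only through \<open>x * stein_sol a x\<close>. Within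
  \<delta> of the corner both terms are at most 2 in absolute value, which costs 4.\<close>

lemma stein_deriv_difference_quotient:
  assumes "\<delta> > 0"
  shows "\<bar>stein_deriv a y - (stein_sol a (y + \<delta>) - stein_sol a (y - \<delta>)) / (2 * \<delta>)\<bar>
           \<le> 2 * \<delta> * \<bar>y\<bar> + 9 * \<delta> + 4 * of_bool (\<bar>y - a\<bar> \<le> \<delta>)"
proof (cases "\<bar>y - a\<bar> \<le> \<delta>")
  case True
  have "\<bar>(stein_sol a (y + \<delta>) - stein_sol a (y - \<delta>)) / (2 * \<delta>)\<bar> \<le> 2"
    using stein_sol_lipschitz[of a "y + \<delta>" "y - \<delta>"] assms by (simp add: field_simps)
  moreover have "0 \<le> 2 * \<delta> * \<bar>y\<bar> + 9 * \<delta>" using assms by simp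
  ultimately show ?thesis
    using abs_stein_deriv_le[of a y] unfolding of_bool_eq_1_iff[THEN iffD2, OF True] by linarith
next
  case False
  hence "y + \<delta> \<le> a \<or> a \<le> y - \<delta>" by linarith
  then obtain \<xi> where \<xi>: "\<xi> > y - \<delta>" "\<xi> < y + \<delta>"
    "stein_sol a (y + \<delta>) - stein_sol a (y - \<delta>) = (y + \<delta> - (y - \<delta>)) * stein_deriv a \<xi>"
    using stein_sol_mvt[of "y - \<delta>" "y + \<delta>" a] assms by auto
  hence "(stein_sol a (y + \<delta>) - stein_sol a (y - \<delta>)) / (2 * \<delta>) = stein_deriv a \<xi>"
    using assms by simp
  \<comment> \<open>The point \<open>a\<close> does not lie between \<open>y\<close> and
    \<open>\<xi>\<close>, so the jump of the indicator is avoided.\<close>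
  moreover have "indicator {..a} y = (indicator {..a} \<xi> :: real)"
    using False \<xi> by (auto simp: indicator_def)
  hence "stein_deriv a y - stein_deriv a \<xi>
      = y * (stein_sol a y - stein_sol a \<xi>) + (y - \<xi>) * stein_sol a \<xi>"
    by (simp add: stein_deriv_def algebra_simps)
  moreover have "\<bar>y * (stein_sol a y - stein_sol a \<xi>)\<bar> \<le> \<bar>y\<bar> * (2 * \<delta>)"
  proof -
    have "\<bar>y - \<xi>\<bar> \<le> \<delta>" using \<xi> by (simp add: abs_le_iff)
    thus ?thesis
      unfolding abs_mult using stein_sol_lipschitz[of a y \<xi>] by (intro mult_left_mono) auto
  qed
  moreover have "\<bar>(y - \<xi>) * stein_sol a \<xi>\<bar> \<le> \<delta> * 9"
    unfolding abs_mult using abs_stein_sol_le[of a \<xi>] \<xi> by (intro mult_mono) auto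
  ultimately show ?thesis by (simp add: False algebra_simps)
qed

text \<open>Stein's equation turns the difference of distribution functions into an expectation that
  the discrete Stein identity would annihilate if derivatives were central differences. The
  discretisation error is what remains; its three terms contribute 4, 9 and 8 to the constant
  21.\<close>

lemma srw_berry_esseen:
  assumes "n > 0"
  shows "\<bar>measure_pmf.prob (srw n 0) {s. of_int s \<le> a * sqrt n} - \<Phi> a\<bar> \<le> 21 / sqrt n"
proof -
  define \<delta> where "\<delta> = 1 / sqrt n"
  have \<delta>: "\<delta> > 0" "real n * \<delta> * \<delta> = 1" "\<delta> * sqrt n = 1"
    using assms by (auto simp: \<delta>_def field_simps)
  define g where "g s = stein_sol a (of_int s * \<delta>)" for s
  let ?A = "{s::int. of_int s \<le> a * sqrt n}" and ?B = "{s::int. \<bar>of_int s - a * sqrt n\<bar> \<le> 1}"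
  \<comment> \<open>The defect of the discrete Stein identity for \<open>g\<close>; its expectation
    is zero.\<close>
  let ?r = "\<lambda>s. real n * (g (s + 1) - g (s - 1)) - of_int s * (g (s + 1) + g (s - 1))"
  have pointwise: "\<bar>(indicator ?A s - \<Phi> a) - \<delta> / 2 * ?r s\<bar> \<le> 4 * \<delta>\<^sup>2 * \<bar>of_int s\<bar> + 9 * \<delta> + 4 * indicator ?B s" for s
  proof -
    let ?y = "of_int s * \<delta>"
    have shift: "of_int (s + 1) * \<delta> = ?y + \<delta>" "of_int (s - 1) * \<delta> = ?y - \<delta>"
      by (simp_all add: algebra_simps)
    have A: "(indicator ?A s :: real) = indicator {..a} ?y"
      using \<delta>(1) assms by (auto simp: indicator_def \<delta>_def field_simps)
    have "?y - a = (of_int s - a * sqrt n) * \<delta>"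
      using \<delta>(3) by (simp add: left_diff_distrib mult.assoc mult.commute[of "sqrt n"])
    hence "\<bar>?y - a\<bar> = \<bar>of_int s - a * sqrt n\<bar> * \<delta>"
      using \<delta>(1) by (simp add: abs_mult)
    hence B: "of_bool (\<bar>?y - a\<bar> \<le> \<delta>) = (indicator ?B s :: real)"
      using \<delta>(1) by (simp add: indicator_def)
    have 1: "\<bar>stein_deriv a ?y - (g (s + 1) - g (s - 1)) / (2 * \<delta>)\<bar> \<le> 2 * \<delta> * \<bar>?y\<bar> + 9 * \<delta> + 4 * indicator ?B s"
      using stein_deriv_difference_quotient[OF \<delta>(1), of a ?y] unfolding g_def shift B .
    have "\<bar>(g (s + 1) + g (s - 1)) / 2 - g s\<bar> \<le> 2 * \<delta>"
      using stein_sol_lipschitz[of a "?y + \<delta>" ?y] stein_sol_lipschitz[of a "?y - \<delta>" ?y] \<delta>(1)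
      unfolding g_def shift abs_le_iff by (auto simp: field_simps)
    hence 2: "\<bar>?y * ((g (s + 1) + g (s - 1)) / 2 - g s)\<bar> \<le> \<bar>?y\<bar> * (2 * \<delta>)"
      unfolding abs_mult by (rule mult_left_mono) simp
    have "(g (s + 1) - g (s - 1)) / (2 * \<delta>) = (real n * \<delta> * \<delta>) * (g (s + 1) - g (s - 1)) / (2 * \<delta>)"
      by (simp add: \<delta>(2))
    hence q: "(g (s + 1) - g (s - 1)) / (2 * \<delta>) = \<delta> / 2 * (real n * (g (s + 1) - g (s - 1)))"
      using \<delta>(1) by simp
    \<comment> \<open>Subtracting the mean-zero defect leaves two discretisation errors: a
      difference quotient in place of the derivative, and the mean of two neighbours in place of
      \<open>g s\<close>.\<close>
    have eq: "(indicator ?A s - \<Phi> a) - \<delta> / 2 * ?r s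
        = (stein_deriv a ?y - (g (s + 1) - g (s - 1)) / (2 * \<delta>)) + ?y * ((g (s + 1) + g (s - 1)) / 2 - g s)"
      unfolding q stein_deriv_def A by (simp add: g_def algebra_simps)
    have "\<bar>(indicator ?A s - \<Phi> a) - \<delta> / 2 * ?r s\<bar>
        \<le> \<bar>stein_deriv a ?y - (g (s + 1) - g (s - 1)) / (2 * \<delta>)\<bar> + \<bar>?y * ((g (s + 1) + g (s - 1)) / 2 - g s)\<bar>"
      unfolding eq by (rule abs_triangle_ineq)
    also have "\<dots> \<le> (2 * \<delta> * \<bar>?y\<bar> + 9 * \<delta> + 4 * indicator ?B s) + \<bar>?y\<bar> * (2 * \<delta>)"
      by (rule add_mono[OF 1 2])
    also have "\<dots> = 4 * \<delta>\<^sup>2 * \<bar>of_int s\<bar> + 9 * \<delta> + 4 * indicator ?B s"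
      unfolding abs_mult abs_of_pos[OF \<delta>(1)] power2_eq_square by (simp only: ring_distribs ac_simps)
    finally show ?thesis .
  qed
  have r: "srw_exp n 0 ?r = 0"
    using srw_stein[of n g] by (subst Bochner_Integration.integral_diff) (simp_all only: integrable_srw integral_mult_right_zero diff_self)
  have "measure_pmf.prob (srw n 0) ?A - \<Phi> a = srw_exp n 0 (\<lambda>s. indicator ?A s - \<Phi> a)"
    by (subst Bochner_Integration.integral_diff) simp_all
  also have "\<dots> = srw_exp n 0 (\<lambda>s. indicator ?A s - \<Phi> a) - \<delta> / 2 * srw_exp n 0 ?r"
    unfolding r by simp
  also have "\<dots> = srw_exp n 0 (\<lambda>s. (indicator ?A s - \<Phi> a) - \<delta> / 2 * ?r s)"
    by (subst (3) Bochner_Integration.integral_diff) (simp_all only: integrable_srw integral_mult_right_zero)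
  finally have eq: "measure_pmf.prob (srw n 0) ?A - \<Phi> a = srw_exp n 0 (\<lambda>s. (indicator ?A s - \<Phi> a) - \<delta> / 2 * ?r s)" .
  have "\<bar>measure_pmf.prob (srw n 0) ?A - \<Phi> a\<bar> \<le> srw_exp n 0 (\<lambda>s. \<bar>(indicator ?A s - \<Phi> a) - \<delta> / 2 * ?r s\<bar>)"
    unfolding eq by (rule integral_abs_bound)
  also have "\<dots> \<le> srw_exp n 0 (\<lambda>s. 4 * \<delta>\<^sup>2 * \<bar>of_int s\<bar> + 9 * \<delta> + 4 * indicator ?B s)"
    by (rule integral_mono[OF integrable_srw integrable_srw pointwise])
  also have "\<dots> = 4 * \<delta>\<^sup>2 * srw_exp n 0 (\<lambda>s. \<bar>of_int s\<bar>) + 9 * \<delta> + 4 * measure_pmf.prob (srw n 0) ?B"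
    by simp
  also have "\<dots> \<le> 4 * \<delta>\<^sup>2 * sqrt n + 9 * \<delta> + 4 * (2 / sqrt n)"
    by (intro add_mono mult_left_mono srw_abs_moment srw_concentration assms) auto
  also have "\<dots> = 21 / sqrt n"
    by (simp add: power2_eq_square mult.assoc \<delta>(3)) (simp add: \<delta>_def)
  finally show ?thesis .
qed

text \<open>The walk after \<open>k\<close> steps is compared with a normal law of variance
  \<open>k\<close>, and \<open>\<Phi>_scale\<close> then changes the variance to \<open>n\<close>.
  That estimate needs a ratio of at least 1, so for \<open>r < 1\<close> it is used with
  \<open>1 / r\<close> at the point \<open>r * a\<close>.\<close>

lemma srw_cdf_approx:
  fixes n \<eta> a :: real
  assumes "k > 0" "n > 0" "\<bar>real k - n\<bar> \<le> \<eta> * n" "\<eta> \<le> 1 / 2"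
  shows "\<bar>measure_pmf.prob (srw k 0) {s. of_int s \<le> sqrt n * a} - \<Phi> a\<bar> \<le> 21 / sqrt k + \<eta> / sqrt (2 * pi)"
proof -
  define r where "r = sqrt (n / k)"
  have r: "r > 0" "sqrt n * a = (r * a) * sqrt k"
    using assms by (auto simp: r_def real_sqrt_divide)
  have "0 \<le> \<eta> * n" using assms(3) by linarith
  hence \<eta>: "0 \<le> \<eta>" using assms(2) by (simp add: zero_le_mult_iff)
  have "\<bar>\<Phi> (r * a) - \<Phi> a\<bar> \<le> \<eta> / sqrt (2 * pi)"
  proof (cases "r \<ge> 1")
    case True
    \<comment> \<open>The square root in \<open>r\<close> helps: the product of (1 + \<eta>) squared
      and 1 - \<eta> is at least 1 for \<eta> up to 1/2, so \<open>r\<close> is at most 1 + \<eta>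
      and the constant in front of \<eta> stays sharp.\<close>
    have "n \<le> (1 + \<eta>)\<^sup>2 * ((1 - \<eta>) * n)"
    proof -
      have "\<eta> * (\<eta> + \<eta>\<^sup>2) \<le> \<eta> * 1"
        using \<eta> assms(4) power_mono[of \<eta> "1/2" 2] by (intro mult_left_mono) (auto simp: power2_eq_square)
      hence "1 \<le> (1 + \<eta>)\<^sup>2 * (1 - \<eta>)" by (simp add: power2_eq_square algebra_simps)
      thus ?thesis using assms(2) by (simp add: mult.assoc[symmetric])
    qed
    also have "\<dots> \<le> (1 + \<eta>)\<^sup>2 * k"
      using assms(3) by (intro mult_left_mono) (auto simp: algebra_simps)
    finally have "n / k \<le> (1 + \<eta>)\<^sup>2" using assms(1) by (simp add: field_simps)
    hence "r \<le> 1 + \<eta>" unfolding r_def using \<eta> by (intro real_le_lsqrt) auto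
    hence "(r - 1) / sqrt (2 * pi) \<le> \<eta> / sqrt (2 * pi)" by (intro divide_right_mono) auto
    thus ?thesis using \<Phi>_scale[OF True, of a] by linarith
  next
    case False
    have "k / n \<le> (1 + \<eta>)\<^sup>2"
    proof -
      have "real k \<le> (1 + \<eta>) * n" using assms(3) by (simp add: algebra_simps)
      also have "\<dots> \<le> (1 + \<eta>)\<^sup>2 * n"
        using \<eta> assms(2) by (intro mult_right_mono) (auto simp: power2_eq_square)
      finally show ?thesis using assms(2) by (simp add: field_simps)
    qed
    hence "1 / r \<le> 1 + \<eta>"
      unfolding r_def using \<eta> real_le_lsqrt[of "1 + \<eta>" "k / n"] by (simp add: real_sqrt_divide)
    hence "(1 / r - 1) / sqrt (2 * pi) \<le> \<eta> / sqrt (2 * pi)" by (intro divide_right_mono) auto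
    moreover have "\<bar>\<Phi> (1 / r * (r * a)) - \<Phi> (r * a)\<bar> \<le> (1 / r - 1) / sqrt (2 * pi)"
      using False r(1) by (intro \<Phi>_scale) (simp add: field_simps)
    ultimately show ?thesis using r(1) by (simp add: abs_minus_commute)
  qed
  moreover have "\<bar>measure_pmf.prob (srw k 0) {s. of_int s \<le> sqrt n * a} - \<Phi> (r * a)\<bar> \<le> 21 / sqrt k"
    unfolding r(2) by (rule srw_berry_esseen) fact
  ultimately show ?thesis by linarith
qed

text \<open>Passing to the strict inequality loses at most an atom at the endpoint, which the
  concentration bound controls by \<open>2 / sqrt k\<close>.\<close>

lemma srw_cdf_left_approx:
  fixes n \<eta> a :: real
  assumes "k > 0" "n > 0" "\<bar>real k - n\<bar> \<le> \<eta> * n" "\<eta> \<le> 1 / 2"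
  shows "\<bar>measure_pmf.prob (srw k 0) {s. of_int s < sqrt n * a} - \<Phi> a\<bar> \<le> 23 / sqrt k + \<eta> / sqrt (2 * pi)"
proof -
  let ?P = "measure_pmf.prob (srw k 0)"
  have "?P {s. of_int s \<le> sqrt n * a} \<le> ?P ({s. of_int s < sqrt n * a} \<union> {s. \<bar>of_int s - sqrt n * a\<bar> \<le> 1})"
    by (intro measure_pmf.finite_measure_mono) auto
  also have "\<dots> \<le> ?P {s. of_int s < sqrt n * a} + ?P {s. \<bar>of_int s - sqrt n * a\<bar> \<le> 1}"
    by (rule measure_Un_le) auto
  also have "?P {s. \<bar>of_int s - sqrt n * a\<bar> \<le> 1} \<le> 2 / sqrt k"
    by (rule srw_concentration) fact
  finally have "?P {s. of_int s \<le> sqrt n * a} \<le> ?P {s. of_int s < sqrt n * a} + 2 / sqrt k" by simp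
  moreover have "?P {s. of_int s < sqrt n * a} \<le> ?P {s. of_int s \<le> sqrt n * a}"
    by (intro measure_pmf.finite_measure_mono) auto
  ultimately show ?thesis
    using srw_cdf_approx[OF assms, of a] by (simp add: abs_le_iff add_divide_distrib[symmetric])
qed

section \<open>Normal approximation on bounded intervals\<close>

lemma bounded_interval_sandwich:
  fixes I :: "real set"
  assumes "is_interval I" "bounded I" "I \<noteq> {}"
  obtains a b where "a \<le> b" "{a<..<b} \<subseteq> I" "I \<subseteq> {a..b}"
proof
  have bdd: "bdd_above I" "bdd_below I"
    using assms(2) by (auto simp: bounded_imp_bdd_above bounded_imp_bdd_below)
  show "I \<subseteq> {Inf I..Sup I}" using bdd by (auto intro: cInf_lower cSup_upper)
  thus "Inf I \<le> Sup I" using assms(3) by force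
  show "{Inf I<..<Sup I} \<subseteq> I"
  proof
    fix x assume x: "x \<in> {Inf I<..<Sup I}"
    obtain u v where "u \<in> I" "u < x" "v \<in> I" "x < v"
      using x cInf_lessD[OF assms(3), of x] less_cSupD[OF assms(3), of x] by auto
    thus "x \<in> I" using assms(1) unfolding is_interval_1 by (meson less_imp_le)
  qed
qed

lemma measure_std_normal_between:
  assumes "a \<le> b" "{a<..<b} \<subseteq> I" "I \<subseteq> {a..b}" "I \<in> sets borel"
  shows "measure std_normal_distribution I = \<Phi> b - \<Phi> a"
proof (rule antisym)
  have "measure std_normal_distribution I \<le> measure std_normal_distribution ({..b} - {..<a})"
    using assms by (intro std_normal.finite_measure_mono) auto
  also have "\<dots> = \<Phi> b - \<Phi> a"
    using assms(1) by (subst std_normal.finite_measure_Diff) (auto simp: measure_std_normal_lessThan cdf_def)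
  finally show "measure std_normal_distribution I \<le> \<Phi> b - \<Phi> a" .
  show "\<Phi> b - \<Phi> a \<le> measure std_normal_distribution I"
  \<comment> \<open>For \<open>a = b\<close> the set \<open>{..a}\<close> is not contained in
    \<open>{..<b}\<close>, so the difference formula needs \<open>a < b\<close>.\<close>
  proof (cases "a = b")
    case False
    hence "\<Phi> b - \<Phi> a = measure std_normal_distribution ({..<b} - {..a})"
      using assms(1) by (subst std_normal.finite_measure_Diff) (auto simp: measure_std_normal_lessThan cdf_def)
    also have "\<dots> \<le> measure std_normal_distribution I"
    proof (rule std_normal.finite_measure_mono)
      have "{..<b} - {..a} = {a<..<b}" by auto
      thus "{..<b} - {..a} \<subseteq> I" using assms(2) by simp
    qed (use assms(4) in simp)
    finally show ?thesis .
  qed simp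
qed

text \<open>Each of the two bounds combines a weak inequality at one endpoint with a strict one at
  the other, so the errors add to 21 + 23 = 44. Rescaling costs
  \<open>\<eta> / sqrt (2 * pi)\<close> per endpoint.\<close>

lemma srw_interval_approx:
  fixes n \<eta> :: real
  assumes "k > 0" "n > 0" "\<bar>real k - n\<bar> \<le> \<eta> * n" "\<eta> \<le> 1 / 2" "is_interval I" "bounded I"
  shows "\<bar>measure_pmf.prob (srw k 0) {s. of_int s \<in> (\<lambda>x. sqrt n * x) ` I} - measure std_normal_distribution I\<bar>
           \<le> 44 / sqrt k + sqrt (2 / pi) * \<eta>"
proof -
  let ?P = "measure_pmf.prob (srw k 0)" and ?J = "{s::int. of_int s \<in> (\<lambda>x. sqrt n * x) ` I}"
  have "0 \<le> \<eta> * n" using assms(3) by linarith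
  hence \<eta>: "0 \<le> \<eta>" using assms(2) by (simp add: zero_le_mult_iff)
  have two: "2 * (\<eta> / sqrt (2 * pi)) = sqrt (2 / pi) * \<eta>"
    by (simp add: real_sqrt_divide real_sqrt_mult field_simps)
  show ?thesis
  proof (cases "I = {}")
    case True
    thus ?thesis using \<eta> by simp
  next
    case False
    obtain a b where ab: "a \<le> b" "{a<..<b} \<subseteq> I" "I \<subseteq> {a..b}"
      using bounded_interval_sandwich[OF assms(5,6) False] .
    have I: "I \<in> sets borel" using assms(5) by (rule real_interval_borel_measurable)
    note normal = measure_std_normal_between[OF ab I]
    have "sqrt n > 0" using assms(2) by simp
    have "x \<in> (\<lambda>x. sqrt n * x) ` I \<longleftrightarrow> x / sqrt n \<in> I" for x
    proof
      assume "x / sqrt n \<in> I"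
      moreover have "x = sqrt n * (x / sqrt n)" using \<open>sqrt n > 0\<close> by simp
      ultimately show "x \<in> (\<lambda>x. sqrt n * x) ` I" by (rule rev_image_eqI)
    qed (use \<open>sqrt n > 0\<close> in auto)
    hence J: "?J = {s. of_int s / sqrt n \<in> I}" by simp
    have "?P ?J \<le> ?P ({s. of_int s \<le> sqrt n * b} - {s. of_int s < sqrt n * a})"
    proof (intro measure_pmf.finite_measure_mono subsetI)
      fix s assume "s \<in> ?J"
      hence "a \<le> of_int s / sqrt n" "of_int s / sqrt n \<le> b" using ab(3) unfolding J by auto
      thus "s \<in> {s. of_int s \<le> sqrt n * b} - {s. of_int s < sqrt n * a}"
        using \<open>sqrt n > 0\<close> by (simp add: pos_le_divide_eq pos_divide_le_eq mult.commute not_less)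
    qed simp
    also have "\<dots> = ?P {s. of_int s \<le> sqrt n * b} - ?P {s. of_int s < sqrt n * a}"
    proof (rule measure_pmf.finite_measure_Diff)
      have "sqrt n * a \<le> sqrt n * b" using ab(1) \<open>sqrt n > 0\<close> by simp
      thus "{s::int. of_int s < sqrt n * a} \<subseteq> {s. of_int s \<le> sqrt n * b}" by auto
    qed auto
    finally have upper: "?P ?J \<le> ?P {s. of_int s \<le> sqrt n * b} - ?P {s. of_int s < sqrt n * a}" .
    have "?P {s. of_int s < sqrt n * b} \<le> ?P (?J \<union> {s. of_int s \<le> sqrt n * a})"
    proof (intro measure_pmf.finite_measure_mono subsetI)
      fix s :: int assume "s \<in> {s. of_int s < sqrt n * b}"
      hence "s \<in> {s. of_int s \<le> sqrt n * a} \<or> of_int s / sqrt n \<in> {a<..<b}"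
        using \<open>sqrt n > 0\<close> by (auto simp: pos_less_divide_eq pos_divide_less_eq mult.commute not_less)
      thus "s \<in> ?J \<union> {s. of_int s \<le> sqrt n * a}" using ab(2) unfolding J by auto
    qed simp
    also have "\<dots> \<le> ?P ?J + ?P {s. of_int s \<le> sqrt n * a}"
      by (rule measure_Un_le) auto
    finally have lower: "?P {s. of_int s < sqrt n * b} - ?P {s. of_int s \<le> sqrt n * a} \<le> ?P ?J" by simp
    show ?thesis
      using upper lower srw_cdf_approx[OF assms(1-4), of a] srw_cdf_approx[OF assms(1-4), of b]
        srw_cdf_left_approx[OF assms(1-4), of a] srw_cdf_left_approx[OF assms(1-4), of b]
      unfolding normal two[symmetric] abs_le_iff by linarith
  qed
qed

subsection \<open>A von Bahr--Esseen inequality\<close>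

lemma powr_add_le:
  fixes x y p :: real
  assumes "0 \<le> x" "0 \<le> y" "0 < p" "p \<le> 1"
  shows "(x + y) powr p \<le> x powr p + y powr p"
proof -
  \<comment> \<open>The exponent \<open>p - 1\<close> is nonpositive, so replacing the base
    \<open>x + y\<close> by the smaller \<open>u\<close> increases the power.\<close>
  have *: "u * (x + y) powr (p - 1) \<le> u powr p" if "0 \<le> u" "u \<le> x + y" for u
  proof (cases "u = 0")
    case False
    hence "u * (x + y) powr (p - 1) \<le> u powr 1 * u powr (p - 1)"
      using that assms(4) by (auto intro!: mult_left_mono powr_mono2')
    also have "\<dots> = u powr p" by (simp only: powr_add [symmetric]) simp
    finally show ?thesis .
  qed simp
  show ?thesis
  proof (cases "x + y = 0")
    case True
    thus ?thesis using assms by simp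
  next
    case False
    hence "(x + y) powr p = (x + y) powr 1 * (x + y) powr (p - 1)"
      by (simp only: powr_add [symmetric]) simp
    also have "\<dots> = x * (x + y) powr (p - 1) + y * (x + y) powr (p - 1)"
      using assms(1,2) by (simp add: distrib_right)
    also have "\<dots> \<le> x powr p + y powr p"
      using assms(1,2) by (intro add_mono *) auto
    finally show ?thesis .
  qed
qed

text \<open>Convexity: the power lies above its tangent at \<open>u\<close>, by the mean value
  theorem and monotonicity of the derivative. The point \<open>v = 0\<close> is computed directly
  because the derivative rule needs a positive base.\<close>

lemma powr_tangent_nonneg:
  fixes u v \<alpha> :: real
  assumes "0 < u" "0 \<le> v" "1 \<le> \<alpha>"
  shows "u powr \<alpha> + \<alpha> * u powr (\<alpha> - 1) * (v - u) \<le> v powr \<alpha>"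
proof (cases "v = 0")
  case True
  have "u powr (\<alpha> - 1) * u = u powr \<alpha>"
    using assms(1) powr_add[of u "\<alpha> - 1" 1] by simp
  hence "u powr \<alpha> + \<alpha> * u powr (\<alpha> - 1) * (v - u) = u powr \<alpha> * (1 - \<alpha>)"
    using True by (simp add: algebra_simps)
  also have "\<dots> \<le> 0" using assms(3) by (intro mult_nonneg_nonpos) auto
  finally show ?thesis using True by simp
next
  case False
  hence "v > 0" using assms by simp
  have deriv: "((\<lambda>x. x powr \<alpha>) has_real_derivative \<alpha> * x powr (\<alpha> - 1)) (at x)" if "x > 0" for x
    using that by (rule has_real_derivative_powr)
  show ?thesis
  proof (cases u v rule: linorder_cases)
    case less
    obtain z where z: "u < z" "v powr \<alpha> - u powr \<alpha> = (v - u) * (\<alpha> * z powr (\<alpha> - 1))"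
      using MVT2[OF less, of "\<lambda>x. x powr \<alpha>" "\<lambda>x. \<alpha> * x powr (\<alpha> - 1)"] deriv assms(1) by force
    have "(v - u) * (\<alpha> * u powr (\<alpha> - 1)) \<le> (v - u) * (\<alpha> * z powr (\<alpha> - 1))"
      using less z(1) assms by (intro mult_left_mono powr_mono2) auto
    thus ?thesis using z(2) by (simp add: mult_ac)
  next
    case greater
    obtain z where z: "v < z" "z < u" "u powr \<alpha> - v powr \<alpha> = (u - v) * (\<alpha> * z powr (\<alpha> - 1))"
      using MVT2[OF greater, of "\<lambda>x. x powr \<alpha>" "\<lambda>x. \<alpha> * x powr (\<alpha> - 1)"] deriv \<open>v > 0\<close> by force
    have "(u - v) * (\<alpha> * z powr (\<alpha> - 1)) \<le> (u - v) * (\<alpha> * u powr (\<alpha> - 1))"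
      using greater z(1,2) assms by (intro mult_left_mono powr_mono2) auto
    thus ?thesis using z(3) by (simp add: algebra_simps)
  qed simp
qed

text \<open>The signed power is the derivative of the absolute power up to the factor \<alpha>. The
  claim reduces to absolute values, since moving from \<open>x\<close> to \<open>y\<close> changes
  the modulus by at least \<open>sgn x * (y - x)\<close>.\<close>

lemma abs_powr_tangent:
  fixes x y \<alpha> :: real
  assumes "1 < \<alpha>"
  shows "\<bar>x\<bar> powr \<alpha> + \<alpha> * (sgn x * \<bar>x\<bar> powr (\<alpha> - 1)) * (y - x) \<le> \<bar>y\<bar> powr \<alpha>"
proof (cases "x = 0")
  case False
  have "sgn x * (y - x) \<le> \<bar>y\<bar> - \<bar>x\<bar>"
    by (auto simp: sgn_if abs_if)
  hence "\<alpha> * \<bar>x\<bar> powr (\<alpha> - 1) * (sgn x * (y - x)) \<le> \<alpha> * \<bar>x\<bar> powr (\<alpha> - 1) * (\<bar>y\<bar> - \<bar>x\<bar>)"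
    using assms by (intro mult_left_mono) auto
  also have "\<dots> \<le> \<bar>y\<bar> powr \<alpha> - \<bar>x\<bar> powr \<alpha>"
    using powr_tangent_nonneg[of "\<bar>x\<bar>" "\<bar>y\<bar>" \<alpha>] False assms by simp
  finally show ?thesis by (simp add: mult_ac)
qed simp

text \<open>For equal signs subadditivity of the power gives constant 1; for opposite signs each
  power is at most that of the distance, which gives 2.\<close>

lemma signed_powr_hoelder:
  fixes x y p :: real
  assumes "0 < p" "p \<le> 1"
  shows "\<bar>sgn x * \<bar>x\<bar> powr p - sgn y * \<bar>y\<bar> powr p\<bar> \<le> 2 * \<bar>x - y\<bar> powr p"
proof -
  have same: "\<bar>u powr p - v powr p\<bar> \<le> 2 * \<bar>u - v\<bar> powr p" if "0 \<le> u" "0 \<le> v" for u v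
  proof -
    have "u powr p \<le> (v + \<bar>u - v\<bar>) powr p" "v powr p \<le> (u + \<bar>u - v\<bar>) powr p"
      using that assms(1) by (intro powr_mono2; simp)+
    moreover have "(v + \<bar>u - v\<bar>) powr p \<le> v powr p + \<bar>u - v\<bar> powr p" "(u + \<bar>u - v\<bar>) powr p \<le> u powr p + \<bar>u - v\<bar> powr p"
      using that assms by (intro powr_add_le; simp)+
    ultimately have "\<bar>u powr p - v powr p\<bar> \<le> \<bar>u - v\<bar> powr p" by (simp add: abs_le_iff)
    also have "\<dots> \<le> 2 * \<bar>u - v\<bar> powr p" by simp
    finally show ?thesis .
  qed
  have opposite: "u powr p + v powr p \<le> 2 * (u + v) powr p" if "0 \<le> u" "0 \<le> v" for u v
  proof -
    have "u powr p \<le> (u + v) powr p" "v powr p \<le> (u + v) powr p"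
      using that assms(1) by (intro powr_mono2; simp)+
    thus ?thesis by simp
  qed
  consider "0 \<le> x" "0 \<le> y" | "x < 0" "y < 0" | "0 \<le> x" "y < 0" | "x < 0" "0 \<le> y" by linarith
  thus ?thesis
  proof cases
    case 1
    thus ?thesis using same[of x y] by (auto simp: sgn_if)
  next
    case 2
    thus ?thesis using same[of "- x" "- y"] by (simp add: abs_minus_commute)
  next
    case 3
    have "sgn x * \<bar>x\<bar> powr p = x powr p" "sgn y * \<bar>y\<bar> powr p = - ((- y) powr p)"
      using 3 by (simp_all add: sgn_if)
    thus ?thesis using opposite[of x "- y"] 3 by (simp only:) simp
  next
    case 4
    have "sgn x * \<bar>x\<bar> powr p = - ((- x) powr p)" "sgn y * \<bar>y\<bar> powr p = y powr p"
      using 4 by (simp_all add: sgn_if)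
    moreover have "\<bar>- ((- x) powr p) - y powr p\<bar> = (- x) powr p + y powr p"
      using powr_ge_zero[of "- x" p] powr_ge_zero[of y p] by linarith
    ultimately show ?thesis using opposite[of "- x" y] 4 by (simp only:) simp
  qed
qed

text \<open>If \<open>b\<close> is a centred random variable independent of \<open>a\<close>, then the middle term integrates
  to zero; this gives the von Bahr--Esseen inequality for sums of independent centred variables.\<close>

lemma abs_powr_add_le:
  fixes a b \<alpha> :: real
  assumes "1 < \<alpha>" "\<alpha> \<le> 2"
  shows "\<bar>a + b\<bar> powr \<alpha> \<le> \<bar>a\<bar> powr \<alpha> + \<alpha> * (sgn a * \<bar>a\<bar> powr (\<alpha> - 1)) * b + 4 * \<bar>b\<bar> powr \<alpha>"
proof -
  let ?s = "\<lambda>x::real. sgn x * \<bar>x\<bar> powr (\<alpha> - 1)"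
  have "(?s (a + b) - ?s a) * b \<le> \<bar>?s (a + b) - ?s a\<bar> * \<bar>b\<bar>"
    by (metis abs_ge_self abs_mult)
  also have "\<dots> \<le> (2 * \<bar>b\<bar> powr (\<alpha> - 1)) * \<bar>b\<bar>"
    using signed_powr_hoelder[of "\<alpha> - 1" "a + b" a] assms by (intro mult_right_mono) auto
  also have "\<dots> = 2 * \<bar>b\<bar> powr \<alpha>"
    using powr_add[of "\<bar>b\<bar>" "\<alpha> - 1" 1] by simp
  finally have "\<alpha> * ((?s (a + b) - ?s a) * b) \<le> \<alpha> * (2 * \<bar>b\<bar> powr \<alpha>)"
    using assms by (intro mult_left_mono) auto
  also have "\<dots> \<le> 2 * (2 * \<bar>b\<bar> powr \<alpha>)"
    using assms by (intro mult_right_mono) auto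
  finally have "\<alpha> * ((?s (a + b) - ?s a) * b) \<le> 2 * (2 * \<bar>b\<bar> powr \<alpha>)" .
  \<comment> \<open>The tangent is taken at \<open>a + b\<close> and evaluated at \<open>a\<close>.
    Exchanging its slope for the slope at \<open>a\<close> costs the Hoelder term, and \<alpha>
    \<le> 2 yields the constant 4.\<close>
  moreover have "\<bar>a + b\<bar> powr \<alpha> + \<alpha> * ?s (a + b) * (a - (a + b)) \<le> \<bar>a\<bar> powr \<alpha>"
    by (rule abs_powr_tangent) fact
  ultimately show ?thesis by (simp add: algebra_simps)
qed

section \<open>Arrival times of the jumps and their moments\<close>

primrec arrival_time :: "nat pmf \<Rightarrow> nat \<Rightarrow> nat pmf" where
  "arrival_time p 0 = return_pmf 0"
| "arrival_time p (Suc k) = bind_pmf p (\<lambda>\<tau>. map_pmf (\<lambda>s. s + Suc \<tau>) (arrival_time p k))"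

text \<open>The definition peels off the first waiting time, like \<open>jump_count\<close>. For
  moments the new waiting time has to be the inner integral, with the earlier sum held
  fixed.\<close>

lemma arrival_time_Suc_last:
  "arrival_time p (Suc k) = bind_pmf (arrival_time p k) (\<lambda>s. map_pmf (\<lambda>\<tau>. s + Suc \<tau>) p)"
  by (simp only: arrival_time.simps map_pmf_def) (rule bind_commute_pmf)

text \<open>By induction on \<open>k\<close>: the new centred waiting time is independent of the
  past, so the linear term of \<open>abs_powr_add_le\<close> integrates to zero and each step adds
  four times the centred moment. Nonnegative integrals avoid carrying integrability of the
  sums.\<close>

lemma arrival_time_moment:
  fixes p :: "nat pmf" and \<alpha> m :: real
  assumes \<alpha>: "1 < \<alpha>" "\<alpha> \<le> 2"
    and int: "integrable p real" and m: "m = measure_pmf.expectation p real"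
    and int\<alpha>: "integrable p (\<lambda>\<tau>. \<bar>real \<tau> - m\<bar> powr \<alpha>)"
  shows "(\<integral>\<^sup>+s. ennreal (\<bar>real s - real k * (m + 1)\<bar> powr \<alpha>) \<partial>arrival_time p k)
           \<le> ennreal (4 * real k * measure_pmf.expectation p (\<lambda>\<tau>. \<bar>real \<tau> - m\<bar> powr \<alpha>))"
proof (induction k)
  case 0
  show ?case by (simp add: \<alpha>)
next
  case (Suc k)
  let ?c = "measure_pmf.expectation p (\<lambda>\<tau>. \<bar>real \<tau> - m\<bar> powr \<alpha>)"
  have c: "?c \<ge> 0" by simp
  have step: "(\<integral>\<^sup>+\<tau>. ennreal (\<bar>real (s + Suc \<tau>) - real (Suc k) * (m + 1)\<bar> powr \<alpha>) \<partial>p)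
      \<le> ennreal (\<bar>real s - real k * (m + 1)\<bar> powr \<alpha>) + ennreal (4 * ?c)" for s
  proof -
    define a where "a = real s - real k * (m + 1)"
    define d where "d = \<alpha> * (sgn a * \<bar>a\<bar> powr (\<alpha> - 1))"
    have le: "\<bar>real (s + Suc \<tau>) - real (Suc k) * (m + 1)\<bar> powr \<alpha>
        \<le> \<bar>a\<bar> powr \<alpha> + d * (real \<tau> - m) + 4 * \<bar>real \<tau> - m\<bar> powr \<alpha>" for \<tau>
    proof -
      have "real (s + Suc \<tau>) - real (Suc k) * (m + 1) = a + (real \<tau> - m)"
        by (simp add: a_def algebra_simps)
      thus ?thesis unfolding d_def by (simp only: abs_powr_add_le[OF \<alpha>])
    qed
    have "(\<integral>\<^sup>+\<tau>. ennreal (\<bar>real (s + Suc \<tau>) - real (Suc k) * (m + 1)\<bar> powr \<alpha>) \<partial>p)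
        \<le> (\<integral>\<^sup>+\<tau>. ennreal (\<bar>a\<bar> powr \<alpha> + d * (real \<tau> - m) + 4 * \<bar>real \<tau> - m\<bar> powr \<alpha>) \<partial>p)"
      using le by (intro nn_integral_mono ennreal_leI)
    also have "\<dots> = ennreal (measure_pmf.expectation p (\<lambda>\<tau>. \<bar>a\<bar> powr \<alpha> + d * (real \<tau> - m) + 4 * \<bar>real \<tau> - m\<bar> powr \<alpha>))"
    proof (rule nn_integral_eq_integral)
      \<comment> \<open>The linear term may be negative, but the whole expression dominates a
        power.\<close>
      show "AE \<tau> in p. 0 \<le> \<bar>a\<bar> powr \<alpha> + d * (real \<tau> - m) + 4 * \<bar>real \<tau> - m\<bar> powr \<alpha>"
        using order_trans[OF powr_ge_zero le] by (intro AE_I2)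
    qed (use int int\<alpha> in auto)
    also have "measure_pmf.expectation p (\<lambda>\<tau>. \<bar>a\<bar> powr \<alpha> + d * (real \<tau> - m) + 4 * \<bar>real \<tau> - m\<bar> powr \<alpha>)
        = \<bar>a\<bar> powr \<alpha> + 4 * ?c"
      using int int\<alpha> by (simp add: m)
    finally show ?thesis using c by (simp add: a_def)
  qed
  have "(\<integral>\<^sup>+s. ennreal (\<bar>real s - real (Suc k) * (m + 1)\<bar> powr \<alpha>) \<partial>arrival_time p (Suc k))
      = (\<integral>\<^sup>+s. (\<integral>\<^sup>+\<tau>. ennreal (\<bar>real (s + Suc \<tau>) - real (Suc k) * (m + 1)\<bar> powr \<alpha>) \<partial>p) \<partial>arrival_time p k)"
    unfolding arrival_time_Suc_last by simp
  also have "\<dots> \<le> (\<integral>\<^sup>+s. ennreal (\<bar>real s - real k * (m + 1)\<bar> powr \<alpha>) + ennreal (4 * ?c) \<partial>arrival_time p k)"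
    by (intro nn_integral_mono step)
  also have "\<dots> = (\<integral>\<^sup>+s. ennreal (\<bar>real s - real k * (m + 1)\<bar> powr \<alpha>) \<partial>arrival_time p k) + ennreal (4 * ?c)"
    by (subst nn_integral_add) auto
  also have "\<dots> \<le> ennreal (4 * real k * ?c) + ennreal (4 * ?c)"
    by (intro add_right_mono Suc.IH)
  also have "\<dots> = ennreal (4 * real (Suc k) * ?c)"
    using c by (subst ennreal_plus[symmetric]) (auto simp: algebra_simps)
  finally show ?case .
qed

text \<open>Markov's inequality for the \<alpha>-th absolute central moment.\<close>

lemma arrival_time_deviation:
  fixes p :: "nat pmf" and \<alpha> m :: real
  assumes "1 < \<alpha>" "\<alpha> \<le> 2" "integrable p real" "m = measure_pmf.expectation p real"
    "integrable p (\<lambda>\<tau>. \<bar>real \<tau> - m\<bar> powr \<alpha>)" and x: "x > 0"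
  shows "measure_pmf.prob (arrival_time p k) {s. x \<le> \<bar>real s - real k * (m + 1)\<bar>}
           \<le> 4 * real k * measure_pmf.expectation p (\<lambda>\<tau>. \<bar>real \<tau> - m\<bar> powr \<alpha>) / x powr \<alpha>"
proof -
  let ?c = "measure_pmf.expectation p (\<lambda>\<tau>. \<bar>real \<tau> - m\<bar> powr \<alpha>)"
  let ?A = "{s. x \<le> \<bar>real s - real k * (m + 1)\<bar>}"
  have xp: "x powr \<alpha> > 0" using x by simp
  have "ennreal (x powr \<alpha> * measure_pmf.prob (arrival_time p k) ?A) = (\<integral>\<^sup>+s. ennreal (x powr \<alpha>) * indicator ?A s \<partial>arrival_time p k)"
    by (simp add: nn_integral_cmult_indicator ennreal_mult' measure_pmf.emeasure_eq_measure)
  also have "\<dots> \<le> (\<integral>\<^sup>+s. ennreal (\<bar>real s - real k * (m + 1)\<bar> powr \<alpha>) \<partial>arrival_time p k)"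
    using x assms(1) by (intro nn_integral_mono) (auto simp: indicator_def intro!: ennreal_leI powr_mono2)
  also have "\<dots> \<le> ennreal (4 * real k * ?c)"
    by (rule arrival_time_moment) fact+
  finally have "x powr \<alpha> * measure_pmf.prob (arrival_time p k) ?A \<le> 4 * real k * ?c"
    by (subst (asm) ennreal_le_iff) auto
  thus ?thesis using xp by (simp add: pos_le_divide_eq mult.commute)
qed

subsection \<open>Jump counts and the law of the position\<close>

text \<open>The recursion conditions on the first trapping time \<open>\<tau>\<close>: the first jump happens at time \<open>\<tau> + 1\<close>.\<close>

function jump_count :: "nat pmf \<Rightarrow> nat \<Rightarrow> nat pmf" where
  "jump_count p t = bind_pmf p (\<lambda>\<tau>. if \<tau> < t then map_pmf Suc (jump_count p (t - Suc \<tau>)) else return_pmf 0)"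
  by auto
termination by (relation "Wellfounded.measure snd") auto

declare jump_count.simps [simp del]

text \<open>Renewal duality: at least \<open>k\<close> jumps occur by time \<open>t\<close> exactly
  when the \<open>k\<close>-th arrival is no later than \<open>t\<close>. Both sides are conditioned
  on the first trapping time.\<close>

lemma prob_jump_count_ge:
  "measure_pmf.prob (jump_count p t) {k..} = measure_pmf.prob (arrival_time p k) {..t}"
proof -
  have "emeasure (jump_count p t) {k..} = emeasure (arrival_time p k) {..t}"
  proof (induction k arbitrary: t)
    case 0
    have "{0::nat..} = UNIV" by auto
    thus ?case by (simp add: indicator_def measure_pmf.emeasure_space_1[simplified])
  next
    case (Suc k)
    have "emeasure (if \<tau> < t then map_pmf Suc (jump_count p (t - Suc \<tau>)) else return_pmf 0) {Suc k..}
        = emeasure (map_pmf (\<lambda>s. s + Suc \<tau>) (arrival_time p k)) {..t}" for \<tau>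
    proof (cases "\<tau> < t")
      case True
      have "Suc -` {Suc k..} = {k..}" "(\<lambda>s. Suc (s + \<tau>)) -` {..t} = {..t - Suc \<tau>}" using True by auto
      thus ?thesis using True Suc.IH[of "t - Suc \<tau>"] by simp
    next
      case False
      hence "(\<lambda>s. Suc (s + \<tau>)) -` {..t} = {}" by auto
      thus ?thesis using False by simp
    qed
    thus ?case by (subst jump_count.simps) simp
  qed
  thus ?thesis by (simp add: measure_def)
qed

section \<open>The trapped walk as a composition of kernels\<close>

fun trap_kernel :: "nat pmf \<Rightarrow> int \<times> nat \<Rightarrow> (int \<times> nat) pmf" where
  "trap_kernel p (z, 0) = bind_pmf (pmf_of_set {z - 1, z + 1}) (\<lambda>z'. map_pmf (Pair z') p)"
| "trap_kernel p (z, Suc \<tau>) = return_pmf (z, \<tau>)"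

lemma pmf_trap_kernel: "pmf (trap_kernel p s) s' = trapped_transition p s s'"
proof -
  obtain z \<tau> z' \<tau>' where s: "s = (z, \<tau>)" "s' = (z', \<tau>')" by (cases s, cases s') auto
  have map: "pmf (map_pmf (Pair y) p) (z', \<tau>') = (if y = z' then pmf p \<tau>' else 0)" for y
  proof (cases "y = z'")
    case True
    thus ?thesis by (simp add: pmf_map_inj' inj_on_def)
  qed (auto intro: pmf_map_outside)
  show ?thesis
  proof (cases \<tau>)
    case 0
    have "\<bar>z - z'\<bar> = 1 \<longleftrightarrow> z' = z - 1 \<or> z' = z + 1" by auto
    thus ?thesis
      by (auto simp: s 0 trapped_transition_def pmf_bind_pmf_of_set map)
  qed (auto simp: s trapped_transition_def indicator_def)
qed

primrec kernel_power :: "('s \<Rightarrow> 's pmf) \<Rightarrow> nat \<Rightarrow> 's \<Rightarrow> 's pmf" where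
  "kernel_power K 0 s = return_pmf s"
| "kernel_power K (Suc t) s = bind_pmf (K s) (kernel_power K t)"

lemma kernel_power_0 [simp]: "kernel_power K 0 = return_pmf"
  by (rule ext) simp

text \<open>The position law conditions on the first step, whereas the law of a given chain is
  extended at its last step; this links the two.\<close>

lemma kernel_power_Suc_last: "kernel_power K (Suc t) s = bind_pmf (kernel_power K t s) K"
proof (induction t arbitrary: s)
  case (Suc t)
  have "kernel_power K (Suc (Suc t)) s = bind_pmf (K s) (\<lambda>s'. bind_pmf (kernel_power K t s') K)"
    unfolding kernel_power.simps(2)[of K "Suc t"] by (intro bind_pmf_cong refl Suc.IH)
  thus ?case by (simp add: bind_assoc_pmf)
qed (simp add: bind_return_pmf bind_return_pmf')

text \<open>Nothing moves before time \<tau> + 1. From then on jump directions and trapping times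
  are drawn independently, so the position is a simple random walk run for an independent number of
  jumps.\<close>

lemma trapped_position_law:
  "map_pmf fst (kernel_power (trap_kernel p) t (z, \<tau>)) =
     (if t \<le> \<tau> then return_pmf z else bind_pmf (jump_count p (t - Suc \<tau>)) (\<lambda>k. srw (Suc k) z))"
proof (induction t arbitrary: z \<tau>)
  case 0
  show ?case by simp
next
  case (Suc t)
  show ?case
  proof (cases \<tau>)
    case (Suc \<tau>')
    thus ?thesis using Suc.IH[of z \<tau>'] by (simp add: bind_return_pmf)
  next
    case 0
    let ?S = "pmf_of_set {z - 1, z + 1}"
    let ?J = "\<lambda>\<tau>'. if \<tau>' < t then map_pmf Suc (jump_count p (t - Suc \<tau>')) else return_pmf 0"
    have "map_pmf fst (kernel_power (trap_kernel p) (Suc t) (z, \<tau>))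
        = bind_pmf ?S (\<lambda>z'. bind_pmf p (\<lambda>\<tau>'. if t \<le> \<tau>' then return_pmf z'
            else bind_pmf (jump_count p (t - Suc \<tau>')) (\<lambda>k. srw (Suc k) z')))"
      by (simp add: 0 map_bind_pmf bind_assoc_pmf bind_map_pmf Suc.IH)
    \<comment> \<open>A trap outlasting the remaining time means zero further jumps, and
      \<open>srw 0 z'\<close> is the point mass at \<open>z'\<close>; both cases thus take one
      form.\<close>
    also have "\<dots> = bind_pmf ?S (\<lambda>z'. bind_pmf p (\<lambda>\<tau>'. bind_pmf (?J \<tau>') (\<lambda>k. srw k z')))"
      by (intro bind_pmf_cong refl) (auto simp: bind_map_pmf bind_return_pmf)
    \<comment> \<open>The direction of the jump is moved past all waiting times until it becomes the
      first step of \<open>srw (Suc k)\<close>.\<close>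
    also have "\<dots> = bind_pmf p (\<lambda>\<tau>'. bind_pmf ?S (\<lambda>z'. bind_pmf (?J \<tau>') (\<lambda>k. srw k z')))"
      by (rule bind_commute_pmf)
    also have "\<dots> = bind_pmf p (\<lambda>\<tau>'. bind_pmf (?J \<tau>') (\<lambda>k. bind_pmf ?S (\<lambda>z'. srw k z')))"
      by (intro bind_pmf_cong refl bind_commute_pmf)
    also have "\<dots> = bind_pmf (jump_count p t) (\<lambda>k. srw (Suc k) z)"
      by (subst jump_count.simps[of p t]) (simp add: bind_assoc_pmf srw.simps(2))
    finally show ?thesis by (simp add: 0)
  qed
qed

text \<open>The initial trapping time also has law \<open>p\<close>, so it acts as the first waiting
  time in \<open>jump_count p t\<close>.\<close>

lemma trapped_position_law_origin:
  "map_pmf fst (bind_pmf p (\<lambda>\<tau>. kernel_power (trap_kernel p) t (0, \<tau>))) =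
     bind_pmf (jump_count p t) (\<lambda>k. srw k 0)"
proof -
  have "map_pmf fst (bind_pmf p (\<lambda>\<tau>. kernel_power (trap_kernel p) t (0, \<tau>)))
      = bind_pmf p (\<lambda>\<tau>. bind_pmf (if \<tau> < t then map_pmf Suc (jump_count p (t - Suc \<tau>)) else return_pmf 0) (\<lambda>k. srw k 0))"
    unfolding map_bind_pmf trapped_position_law
    by (intro bind_pmf_cong refl) (auto simp: bind_map_pmf bind_return_pmf)
  also have "\<dots> = bind_pmf (jump_count p t) (\<lambda>k. srw k 0)"
    by (subst jump_count.simps[of p t]) (simp add: bind_assoc_pmf)
  finally show ?thesis .
qed

section \<open>One-time laws of a Markov chain given by its transition probabilities\<close>

context
  fixes M :: "'a measure" and q :: "'s::countable \<Rightarrow> 's \<Rightarrow> real" and Z :: "nat \<Rightarrow> 'a \<Rightarrow> 's"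
  assumes chain: "markov_chain M q Z"
begin

interpretation prob_space M
  using chain by (simp add: markov_chain_def)

lemma Z_measurable [measurable]: "Z t \<in> measurable M (count_space UNIV)"
  using chain by (simp add: markov_chain_def)

text \<open>Times before \<open>j\<close> are left free: \<open>j = 0\<close> is a full history as
  in \<open>markov_chain\<close>, and \<open>j = m\<close> fixes a single state.\<close>

definition path_event :: "nat \<Rightarrow> nat \<Rightarrow> (nat \<Rightarrow> 's) \<Rightarrow> 'a set" where
  "path_event j m s = {\<omega> \<in> space M. \<forall>i\<in>{j..m}. Z i \<omega> = s i}"

lemma sets_path_event [measurable]: "path_event j m s \<in> sets M"
  unfolding path_event_def by measurable

lemma path_event_0: "path_event 0 t s = {\<omega> \<in> space M. \<forall>i\<le>t. Z i \<omega> = s i}"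
  by (auto simp: path_event_def)

lemma emeasure_path_event_forget:
  assumes "j \<le> m"
  shows "emeasure M (path_event (Suc j) m s) = (\<integral>\<^sup>+v. emeasure M (path_event j m (s(j := v))) \<partial>count_space UNIV)"
proof -
  have "{j..m} = insert j {Suc j..m}" using assms by auto
  hence *: "path_event j m (s(j := v)) = {\<omega> \<in> path_event (Suc j) m s. Z j \<omega> = v}" for v
    by (auto simp: path_event_def)
  hence "path_event (Suc j) m s = (\<Union>v. path_event j m (s(j := v)))" by auto
  also have "emeasure M \<dots> = (\<integral>\<^sup>+v. emeasure M (path_event j m (s(j := v))) \<partial>count_space UNIV)"
    by (rule emeasure_UN_countable) (auto simp: disjoint_family_on_def *)
  finally show ?thesis .
qed

text \<open>\<open>q\<close> is an arbitrary real function, so its sign is read off from the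
  conditional probability it equals after a history of positive probability.\<close>

lemma transition_nonneg:
  assumes "emeasure M (path_event 0 t s) \<noteq> 0"
  shows "q (s t) v \<ge> 0"
proof -
  have "measure M (path_event 0 t s) > 0"
    using assms by (simp add: emeasure_eq_measure zero_less_measure_iff)
  hence "cond_prob M (\<lambda>\<omega>. Z (Suc t) \<omega> = v) (\<lambda>\<omega>. \<forall>i\<le>t. Z i \<omega> = s i) = q (s t) v"
    using chain unfolding markov_chain_def path_event_0 by blast
  from this [symmetric] show ?thesis by (simp add: cond_prob_def)
qed

lemma emeasure_path_event_Suc_start:
  "emeasure M (path_event 0 (Suc t) s) = emeasure M (path_event 0 t s) * ennreal (q (s t) (s (Suc t)))"
proof (cases "emeasure M (path_event 0 t s) = 0")
  \<comment> \<open>After a null history \<open>q\<close> is not constrained, but both sides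
    vanish.\<close>
  case True
  have "path_event 0 (Suc t) s \<subseteq> path_event 0 t s" by (auto simp: path_event_def)
  hence "emeasure M (path_event 0 (Suc t) s) \<le> emeasure M (path_event 0 t s)"
    by (rule emeasure_mono) simp
  thus ?thesis using True by simp
next
  case False
  hence pos: "measure M (path_event 0 t s) > 0"
    by (simp add: emeasure_eq_measure zero_less_measure_iff)
  hence "cond_prob M (\<lambda>\<omega>. Z (Suc t) \<omega> = s (Suc t)) (\<lambda>\<omega>. \<forall>i\<le>t. Z i \<omega> = s i) = q (s t) (s (Suc t))"
    using chain unfolding markov_chain_def path_event_0 by blast
  moreover have "{\<omega> \<in> space M. Z (Suc t) \<omega> = s (Suc t) \<and> (\<forall>i\<le>t. Z i \<omega> = s i)} = path_event 0 (Suc t) s"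
    by (auto simp: path_event_def le_Suc_eq)
  ultimately have "measure M (path_event 0 (Suc t) s) = measure M (path_event 0 t s) * q (s t) (s (Suc t))"
    using pos by (simp add: cond_prob_def path_event_0 field_simps)
  thus ?thesis
    using transition_nonneg[OF False] by (simp add: emeasure_eq_measure ennreal_mult)
qed

text \<open>The prescribed full history is shortened by summing out its earliest state one time at a
  time; the factor \<open>q\<close> depends only on times \<open>t\<close> and \<open>Suc t\<close>
  and comes out of the sum.\<close>

lemma emeasure_path_event_Suc:
  assumes "j \<le> t"
  shows "emeasure M (path_event j (Suc t) s) = emeasure M (path_event j t s) * ennreal (q (s t) (s (Suc t)))"
  using assms
proof (induction j arbitrary: s)
  case 0
  show ?case by (rule emeasure_path_event_Suc_start)
next
  case (Suc j)
  have "emeasure M (path_event (Suc j) (Suc t) s)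
      = (\<integral>\<^sup>+v. emeasure M (path_event j t (s(j := v))) * ennreal (q (s t) (s (Suc t))) \<partial>count_space UNIV)"
    using Suc by (simp add: emeasure_path_event_forget)
  also have "\<dots> = emeasure M (path_event (Suc j) t s) * ennreal (q (s t) (s (Suc t)))"
    using Suc.prems by (simp add: nn_integral_multc emeasure_path_event_forget)
  finally show ?case .
qed

lemma markov_chain_law:
  fixes K :: "'s \<Rightarrow> 's pmf"
  assumes K: "\<And>s s'. pmf (K s) s' = q s s'"
    and init: "\<And>s. measure M {\<omega> \<in> space M. Z 0 \<omega> = s} = pmf \<nu> s"
  shows "distr M (count_space UNIV) (Z t) = measure_pmf (bind_pmf \<nu> (kernel_power K t))"
proof -
  have pe: "path_event t t (\<lambda>_. s) = {\<omega> \<in> space M. Z t \<omega> = s}" for t s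
    by (auto simp: path_event_def)
  have point: "emeasure M (path_event t t (\<lambda>_. s)) = ennreal (pmf (bind_pmf \<nu> (kernel_power K t)) s)" for s
  proof (induction t arbitrary: s)
    case 0
    show ?case unfolding pe by (simp add: emeasure_eq_measure init bind_return_pmf')
  next
    case (Suc t)
    have "emeasure M (path_event (Suc t) (Suc t) (\<lambda>_. s))
        = (\<integral>\<^sup>+v. emeasure M (path_event t (Suc t) ((\<lambda>_. s)(t := v))) \<partial>count_space UNIV)"
      by (rule emeasure_path_event_forget) simp
    also have "\<dots> = (\<integral>\<^sup>+v. emeasure M (path_event t t ((\<lambda>_. s)(t := v))) * ennreal (q v s) \<partial>count_space UNIV)"
      by (simp add: emeasure_path_event_Suc)
    also have "\<dots> = (\<integral>\<^sup>+v. emeasure M (path_event t t (\<lambda>_. v)) * ennreal (q v s) \<partial>count_space UNIV)"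
      by (simp add: path_event_def)
    also have "\<dots> = (\<integral>\<^sup>+v. ennreal (pmf (bind_pmf \<nu> (kernel_power K t)) v) * ennreal (pmf (K v) s) \<partial>count_space UNIV)"
      by (simp add: Suc.IH K)
    also have "\<dots> = ennreal (pmf (bind_pmf (bind_pmf \<nu> (kernel_power K t)) K) s)"
      unfolding ennreal_pmf_bind[where f = K] by (simp add: nn_integral_measure_pmf)
    also have "bind_pmf (bind_pmf \<nu> (kernel_power K t)) K = bind_pmf \<nu> (kernel_power K (Suc t))"
      unfolding bind_assoc_pmf kernel_power_Suc_last ..
    finally show ?case .
  qed
  show ?thesis
  proof (rule measure_eqI_countable[of _ UNIV])
    fix s :: 's
    have "Z t -` {s} \<inter> space M = path_event t t (\<lambda>_. s)" by (auto simp: path_event_def)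
    thus "emeasure (distr M (count_space UNIV) (Z t)) {s} = emeasure (bind_pmf \<nu> (kernel_power K t)) {s}"
      by (simp add: emeasure_distr point emeasure_pmf_single)
  qed auto
qed

end

lemma trapped_walk_position_prob:
  assumes "trapped_random_walk M p X R" "started_at_origin M p X R"
  shows "measure M {\<omega> \<in> space M. X t \<omega> \<in> B} =
           measure_pmf.expectation (jump_count p t) (\<lambda>k. measure_pmf.prob (srw k 0) B)"
proof -
  let ?Z = "\<lambda>t \<omega>. (X t \<omega>, R t \<omega>)" and ?\<nu> = "map_pmf (Pair 0) p :: (int \<times> nat) pmf"
  have chain: "markov_chain M (trapped_transition p) ?Z"
    using assms(1) by (simp add: trapped_random_walk_def)
  have meas: "?Z t \<in> measurable M (count_space UNIV)"
    using chain unfolding markov_chain_def by blast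
  have init: "measure M {\<omega> \<in> space M. ?Z 0 \<omega> = s} = pmf ?\<nu> s" for s
  proof (cases s)
    case (Pair z \<tau>)
    have "pmf ?\<nu> (z, \<tau>) = (if z = 0 then pmf p \<tau> else 0)"
    proof (cases "z = 0")
      case True
      thus ?thesis by (simp add: pmf_map_inj' inj_on_def)
    qed (auto intro: pmf_map_outside)
    thus ?thesis using assms(2) unfolding started_at_origin_def Pair by simp
  qed
  have "bind_pmf ?\<nu> (kernel_power (trap_kernel p) t) = bind_pmf p (\<lambda>\<tau>. kernel_power (trap_kernel p) t (0, \<tau>))"
    by (simp add: bind_map_pmf)
  hence law: "distr M (count_space UNIV) (?Z t) = measure_pmf (bind_pmf p (\<lambda>\<tau>. kernel_power (trap_kernel p) t (0, \<tau>)))"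
    using markov_chain_law[OF chain pmf_trap_kernel init, of t] by simp
  have "measure M {\<omega> \<in> space M. X t \<omega> \<in> B} = measure (distr M (count_space UNIV) (?Z t)) (fst -` B)"
  proof -
    have "{\<omega> \<in> space M. X t \<omega> \<in> B} = ?Z t -` (fst -` B) \<inter> space M" by auto
    thus ?thesis by (simp only: measure_distr[OF meas] sets_count_space Pow_UNIV UNIV_I)
  qed
  also have "\<dots> = measure_pmf.prob (map_pmf fst (bind_pmf p (\<lambda>\<tau>. kernel_power (trap_kernel p) t (0, \<tau>)))) B"
    unfolding law by simp
  also have "\<dots> = measure_pmf.prob (bind_pmf (jump_count p t) (\<lambda>k. srw k 0)) B"
    unfolding trapped_position_law_origin ..
  also have "\<dots> = measure_pmf.expectation (jump_count p t) (\<lambda>k. measure_pmf.prob (srw k 0) B)"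
  proof -
    have "emeasure (bind_pmf (jump_count p t) (\<lambda>k. srw k 0)) B
        = (\<integral>\<^sup>+k. ennreal (measure_pmf.prob (srw k 0) B) \<partial>jump_count p t)"
      unfolding emeasure_bind_pmf by (simp only: measure_pmf.emeasure_eq_measure)
    also have "\<dots> = ennreal (measure_pmf.expectation (jump_count p t) (\<lambda>k. measure_pmf.prob (srw k 0) B))"
      by (intro nn_integral_eq_integral measure_pmf.integrable_const_bound[of _ 1]) auto
    finally show ?thesis
      unfolding measure_pmf.emeasure_eq_measure by (subst (asm) ennreal_inj) (auto intro: Bochner_Integration.integral_nonneg)
  qed
  finally show ?thesis .
qed

subsection \<open>The error bound\<close>

text \<open>Having \<open>k\<close> jumps by time \<open>t\<close> puts the \<open>k\<close>-th
  arrival at least \<open>x\<close> below its mean \<open>k * (m + 1)\<close>. The lower tail is the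
  mirror image.\<close>

lemma jump_count_upper_tail:
  fixes p :: "nat pmf" and \<alpha> m :: real
  assumes p: "1 < \<alpha>" "\<alpha> \<le> 2" "integrable p real" "m = measure_pmf.expectation p real"
    "integrable p (\<lambda>\<tau>. \<bar>real \<tau> - m\<bar> powr \<alpha>)"
    and x: "x > 0" "real k * (m + 1) \<ge> real t + x"
  shows "measure_pmf.prob (jump_count p t) {k..}
           \<le> 4 * real k * measure_pmf.expectation p (\<lambda>\<tau>. \<bar>real \<tau> - m\<bar> powr \<alpha>) / x powr \<alpha>"
proof -
  have "measure_pmf.prob (jump_count p t) {k..}
      \<le> measure_pmf.prob (arrival_time p k) {s. x \<le> \<bar>real s - real k * (m + 1)\<bar>}"
    unfolding prob_jump_count_ge using x(2) by (intro measure_pmf.finite_measure_mono) auto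
  also note arrival_time_deviation[OF p x(1)]
  finally show ?thesis .
qed

lemma jump_count_lower_tail:
  fixes p :: "nat pmf" and \<alpha> m :: real
  assumes p: "1 < \<alpha>" "\<alpha> \<le> 2" "integrable p real" "m = measure_pmf.expectation p real"
    "integrable p (\<lambda>\<tau>. \<bar>real \<tau> - m\<bar> powr \<alpha>)"
    and x: "x > 0" "real k * (m + 1) \<le> real t - x"
  shows "measure_pmf.prob (jump_count p t) {..<k}
           \<le> 4 * real k * measure_pmf.expectation p (\<lambda>\<tau>. \<bar>real \<tau> - m\<bar> powr \<alpha>) / x powr \<alpha>"
proof -
  have compl: "{..<k} = UNIV - {k..}" "UNIV - {..t} = {t<..}" for k t :: nat by auto
  have "measure_pmf.prob (jump_count p t) {..<k} = measure_pmf.prob (arrival_time p k) {t<..}"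
    unfolding compl(1) compl(2) [symmetric]
    by (simp add: measure_pmf.prob_compl [simplified] prob_jump_count_ge)
  also have "\<dots> \<le> measure_pmf.prob (arrival_time p k) {s. x \<le> \<bar>real s - real k * (m + 1)\<bar>}"
    using x(2) by (intro measure_pmf.finite_measure_mono) auto
  also note arrival_time_deviation[OF p x(1)]
  finally show ?thesis .
qed

lemma pmf_expectation_close:
  fixes f :: "'a \<Rightarrow> real"
  assumes "\<And>k. 0 \<le> f k \<and> f k \<le> 1" "0 \<le> c" "c \<le> 1" "0 \<le> \<delta>"
    and good: "\<And>k. k \<notin> A \<Longrightarrow> \<bar>f k - c\<bar> \<le> \<delta>"
  shows "\<bar>measure_pmf.expectation P f - c\<bar> \<le> measure_pmf.prob P A + \<delta>"
proof -
  have intf: "integrable P f"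
    using assms(1) by (intro measure_pmf.integrable_const_bound[of _ 1]) auto
  have inti: "integrable P (\<lambda>k. indicator A k :: real)"
    by (intro measure_pmf.integrable_const_bound[of _ 1]) auto
  have "measure_pmf.expectation P f - c = measure_pmf.expectation P (\<lambda>k. f k - c)"
    using intf by simp
  hence "\<bar>measure_pmf.expectation P f - c\<bar> \<le> measure_pmf.expectation P (\<lambda>k. \<bar>f k - c\<bar>)"
    by (simp only: integral_abs_bound)
  also have "\<dots> \<le> measure_pmf.expectation P (\<lambda>k. indicator A k + \<delta>)"
  proof (rule integral_mono)
    fix k
    show "\<bar>f k - c\<bar> \<le> indicator A k + \<delta>"
    proof (cases "k \<in> A")
      case True
      have "\<bar>f k - c\<bar> \<le> 1" using assms(1)[of k] assms(2,3) by (simp add: abs_le_iff)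
      thus ?thesis using True assms(4) by simp
    qed (simp add: good)
  qed (use intf inti in auto)
  also have "\<dots> = measure_pmf.prob P A + \<delta>" using inti by simp
  finally show ?thesis .
qed

text \<open>Condition on the number of jumps. Counts far from \<open>n\<close> are paid for by the
  two tail bounds; for the others the normal approximation of the simple walk applies.\<close>

lemma trapped_walk_interval_bound:
  fixes p :: "nat pmf" and \<alpha> m :: real and t :: nat
  defines "\<mu> \<equiv> m + 1" and "c \<equiv> measure_pmf.expectation p (\<lambda>\<tau>. \<bar>real \<tau> - m\<bar> powr \<alpha>)"
    and "\<epsilon> \<equiv> real t powr ((1 - \<alpha>) / (1 + \<alpha>))"
  assumes p: "1 < \<alpha>" "\<alpha> \<le> 2" "integrable p real" "m = measure_pmf.expectation p real"
    "integrable p (\<lambda>\<tau>. \<bar>real \<tau> - m\<bar> powr \<alpha>)"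
    and t: "t > 0" "\<epsilon> + \<mu> / real t \<le> 1 / 2"
    and I: "is_interval I" "bounded I"
  shows "\<bar>measure_pmf.expectation (jump_count p t)
            (\<lambda>k. measure_pmf.prob (srw k 0) {s. of_int s \<in> (\<lambda>x. sqrt (real t / \<mu>) * x) ` I})
          - measure std_normal_distribution I\<bar>
         \<le> 4 * c / \<mu> * \<epsilon> * (2 + \<epsilon> + \<mu> / real t) + 44 / sqrt (real t / (2 * \<mu>)) + sqrt (2 / pi) * (\<epsilon> + \<mu> / real t)"
proof -
  define n where "n = real t / \<mu>"
  \<comment> \<open>The summand \<mu> / t is \<open>1 / n\<close>; it leaves room of one jump for
    rounding the thresholds to integers.\<close>
  define \<eta> where "\<eta> = \<epsilon> + \<mu> / real t"
  let ?P = "measure_pmf.prob (jump_count p t)"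
  have "m \<ge> 0" unfolding p(4) by simp
  hence \<mu>: "\<mu> > 0" by (simp add: \<mu>_def)
  have n: "n > 0" "n * \<mu> = real t" using t(1) \<mu> by (simp_all add: n_def)
  have \<epsilon>: "\<epsilon> > 0" using t(1) by (simp add: \<epsilon>_def)
  have \<eta>: "0 < \<eta>" "\<eta> \<le> 1 / 2" using \<epsilon> t \<mu> by (simp_all add: \<eta>_def add_pos_nonneg)
  have n\<eta>: "\<eta> * n = n * \<epsilon> + 1" using t(1) \<mu> by (simp add: \<eta>_def n_def field_simps)
  have c: "c \<ge> 0" by (simp add: c_def)
  \<comment> \<open>This balance fixes the exponent: a deviation of t \<epsilon> has probability of
    order t / (t \<epsilon>)^\<alpha>, and equating this with \<epsilon> gives the stated power of
    t.\<close>
  have scale: "(real t * \<epsilon>) powr \<alpha> = real t / \<epsilon>"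
  proof -
    have "(real t * \<epsilon>) powr \<alpha> = real t powr (\<alpha> + (1 - \<alpha>) / (1 + \<alpha>) * \<alpha>)"
      using t(1) by (simp add: \<epsilon>_def powr_mult powr_powr powr_add)
    also have "\<alpha> + (1 - \<alpha>) / (1 + \<alpha>) * \<alpha> = 1 - (1 - \<alpha>) / (1 + \<alpha>)"
      using p(1) by (simp add: field_simps)
    also have "real t powr \<dots> = real t / \<epsilon>" using t(1) by (simp add: \<epsilon>_def powr_diff)
    finally show ?thesis .
  qed
  define k1 where "k1 = nat \<lfloor>n + n * \<epsilon>\<rfloor> + 1"
  define k2 where "k2 = nat \<lceil>n - n * \<epsilon> - 1\<rceil>"
  have "0 \<le> n + n * \<epsilon>" using n(1) \<epsilon> by simp
  hence k1: "n + n * \<epsilon> < k1" "k1 \<le> n + n * \<epsilon> + 1" unfolding k1_def by linarith+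
  have "\<eta> * n \<le> 1 / 2 * n" using \<eta>(2) n(1) by (intro mult_right_mono) auto
  \<comment> \<open>Since \<open>n - n * \<epsilon> - 1\<close> is at least \<open>n / 2\<close>,
    the conversion to \<open>nat\<close> in \<open>k2\<close> truncates nothing, and every good
    count is at least \<open>n / 2\<close>.\<close>
  hence half: "n / 2 \<le> n - \<eta> * n" by simp
  hence k2: "n - n * \<epsilon> - 1 \<le> k2" "k2 \<le> n - n * \<epsilon>"
    unfolding k2_def using n\<eta> n(1) by linarith+
  have x: "real t * \<epsilon> > 0" using t(1) \<epsilon> by simp
  have bad_upper: "?P {k1..} \<le> 4 * c / \<mu> * \<epsilon> * (1 + \<eta>)"
  proof -
    have "real t + real t * \<epsilon> = (n + n * \<epsilon>) * \<mu>" by (simp add: n(2)[symmetric] algebra_simps)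
    also have "\<dots> \<le> real k1 * \<mu>" using k1(1) \<mu> by (intro mult_right_mono) auto
    finally have "?P {k1..} \<le> 4 * real k1 * c / (real t * \<epsilon>) powr \<alpha>"
      unfolding c_def \<mu>_def by (intro jump_count_upper_tail[OF p x])
    also have "\<dots> = 4 * c * \<epsilon> / real t * k1" by (simp add: scale)
    also have "\<dots> \<le> 4 * c * \<epsilon> / real t * (n * (1 + \<eta>))"
      using k1(2) n\<eta> c \<epsilon> by (intro mult_left_mono) (auto simp: algebra_simps)
    also have "\<dots> = 4 * c / \<mu> * \<epsilon> * (1 + \<eta>)" using t(1) \<mu> by (simp add: n_def)
    finally show ?thesis .
  qed
  have bad_lower: "?P {..<k2} \<le> 4 * c / \<mu> * \<epsilon>"
  proof -
    have "real k2 * \<mu> \<le> (n - n * \<epsilon>) * \<mu>" using k2(2) \<mu> by (intro mult_right_mono) auto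
    also have "\<dots> = real t - real t * \<epsilon>" by (simp add: n(2)[symmetric] algebra_simps)
    finally have "?P {..<k2} \<le> 4 * real k2 * c / (real t * \<epsilon>) powr \<alpha>"
      unfolding c_def \<mu>_def by (intro jump_count_lower_tail[OF p x])
    also have "\<dots> = 4 * c * \<epsilon> / real t * k2" by (simp add: scale)
    also have "\<dots> \<le> 4 * c * \<epsilon> / real t * n"
      using k2(2) n(1) c \<epsilon> by (intro mult_left_mono) (auto intro: order_trans)
    also have "\<dots> = 4 * c / \<mu> * \<epsilon>" using t(1) \<mu> by (simp add: n_def)
    finally show ?thesis .
  qed
  let ?f = "\<lambda>k. measure_pmf.prob (srw k 0) {s. of_int s \<in> (\<lambda>x. sqrt n * x) ` I}"
  have "\<bar>measure_pmf.expectation (jump_count p t) ?f - measure std_normal_distribution I\<bar>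
      \<le> ?P ({k1..} \<union> {..<k2}) + (44 / sqrt (n / 2) + sqrt (2 / pi) * \<eta>)"
  proof (rule pmf_expectation_close)
    fix k assume "k \<notin> {k1..} \<union> {..<k2}"
    hence "k2 \<le> k" "k < k1" by auto
    hence "real k2 \<le> k" "real k \<le> k1" by simp_all
    hence k: "\<bar>real k - n\<bar> \<le> \<eta> * n" using k1(2) k2(1) n\<eta> by (simp add: abs_le_iff)
    \<comment> \<open>The Stein error becomes uniform over the good counts.\<close>
    hence "n / 2 \<le> k" using half by (simp add: abs_le_iff)
    hence "k > 0" using n(1) by (cases "k = 0") auto
    hence "\<bar>?f k - measure std_normal_distribution I\<bar> \<le> 44 / sqrt k + sqrt (2 / pi) * \<eta>"
      by (rule srw_interval_approx[OF _ n(1) k \<eta>(2) I])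
    also have "44 / sqrt k \<le> 44 / sqrt (n / 2)"
      using \<open>n / 2 \<le> k\<close> n(1) by (intro divide_left_mono) auto
    finally show "\<bar>?f k - measure std_normal_distribution I\<bar> \<le> 44 / sqrt (n / 2) + sqrt (2 / pi) * \<eta>"
      by simp
  qed (use n(1) \<eta>(1) in auto)
  also have "?P ({k1..} \<union> {..<k2}) \<le> ?P {k1..} + ?P {..<k2}"
    by (rule measure_Un_le) auto
  also have "\<dots> \<le> 4 * c / \<mu> * \<epsilon> * (1 + \<eta>) + 4 * c / \<mu> * \<epsilon>"
    by (rule add_mono[OF bad_upper bad_lower])
  also have "\<dots> = 4 * c / \<mu> * \<epsilon> * (2 + \<eta>)"
  proof -
    have "x * (1 + \<eta>) + x = x * (2 + \<eta>)" for x by (simp add: algebra_simps)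
    thus ?thesis .
  qed
  finally show ?thesis by (simp add: n_def \<eta>_def mult.commute[of 2] add.assoc)
qed

text \<open>Divided by \<epsilon>, the error tends to \<open>8 * c / \<mu> + sqrt (2 / pi)\<close>,
  which is below \<open>C\<close>. The Stein term vanishes in this limit because the decay exponent
  of \<epsilon> is below 1/2.\<close>

lemma error_eventually_le:
  fixes \<alpha> c \<mu> C :: real
  defines "\<epsilon> \<equiv> \<lambda>t::nat. real t powr ((1 - \<alpha>) / (1 + \<alpha>))"
  assumes "1 < \<alpha>" "\<alpha> \<le> 2" "\<mu> > 0" "C > 8 * c / \<mu> + sqrt (2 / pi)"
  shows "\<forall>\<^sub>F t in sequentially. \<epsilon> t + \<mu> / real t \<le> 1 / 2 \<and>
           4 * c / \<mu> * \<epsilon> t * (2 + \<epsilon> t + \<mu> / real t) + 44 / sqrt (real t / (2 * \<mu>)) + sqrt (2 / pi) * (\<epsilon> t + \<mu> / real t)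
             \<le> C * \<epsilon> t"
proof -
  define \<beta> where "\<beta> = (\<alpha> - 1) / (1 + \<alpha>)"
  have \<beta>: "\<beta> > 0" "\<beta> < 1 / 2" "\<beta> < 1" using assms(2,3) by (simp_all add: \<beta>_def field_simps)
  have "(1 - \<alpha>) / (1 + \<alpha>) = - \<beta>" by (simp add: \<beta>_def minus_divide_left)
  hence \<epsilon>: "\<epsilon> t = real t powr (- \<beta>)" for t by (simp add: \<epsilon>_def)
  have neg: "(\<lambda>t. real t powr s) \<longlonglongrightarrow> 0" if "s < 0" for s
    using that by (rule tendsto_neg_powr) (rule filterlim_real_sequentially)
  have e: "\<epsilon> \<longlonglongrightarrow> 0" unfolding \<epsilon> using neg[of "- \<beta>"] \<beta> by simp
  have mu: "(\<lambda>t. \<mu> / real t) \<longlonglongrightarrow> 0" by (rule lim_const_over_n)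
  let ?q = "\<lambda>t. 4 * c / \<mu> * (2 + \<epsilon> t + \<mu> / real t) + 44 * sqrt (2 * \<mu>) * real t powr (\<beta> - 1 / 2)
              + sqrt (2 / pi) * (1 + \<mu> * real t powr (\<beta> - 1))"
  have "?q \<longlonglongrightarrow> 4 * c / \<mu> * (2 + 0 + 0) + 44 * sqrt (2 * \<mu>) * 0 + sqrt (2 / pi) * (1 + \<mu> * 0)"
    by (intro tendsto_intros e mu neg) (use \<beta> in auto)
  moreover have "4 * c / \<mu> * (2 + 0 + 0) + 44 * sqrt (2 * \<mu>) * 0 + sqrt (2 / pi) * (1 + \<mu> * 0) < C"
    using assms(5) by simp
  ultimately have "\<forall>\<^sub>F t in sequentially. ?q t < C" by (rule order_tendstoD(2))
  moreover have "\<forall>\<^sub>F t in sequentially. \<epsilon> t + \<mu> / real t < 1 / 2"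
    by (rule order_tendstoD(2)[OF tendsto_add[OF e mu]]) simp
  ultimately show ?thesis
    using eventually_gt_at_top[of 0]
  proof eventually_elim
    case (elim t)
    have t: "real t > 0" using elim by simp
    have \<epsilon>0: "\<epsilon> t > 0" using t by (simp add: \<epsilon>)
    have "sqrt (real t / (2 * \<mu>)) = real t powr (1 / 2) / sqrt (2 * \<mu>)"
      using t by (simp add: real_sqrt_divide powr_half_sqrt)
    moreover have "real t powr (\<beta> - 1 / 2) * \<epsilon> t = 1 / real t powr (1 / 2)"
      using t by (simp add: \<epsilon> powr_minus_divide [symmetric] flip: powr_add)
    ultimately have r: "44 / sqrt (real t / (2 * \<mu>)) = 44 * sqrt (2 * \<mu>) * real t powr (\<beta> - 1 / 2) * \<epsilon> t"
      by (simp add: mult.assoc)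
    have s: "\<mu> / real t = \<mu> * real t powr (\<beta> - 1) * \<epsilon> t"
      using t by (simp add: \<epsilon> powr_diff powr_minus field_simps)
    have "4 * c / \<mu> * \<epsilon> t * (2 + \<epsilon> t + \<mu> / real t) + 44 / sqrt (real t / (2 * \<mu>)) + sqrt (2 / pi) * (\<epsilon> t + \<mu> / real t)
        = 4 * c / \<mu> * \<epsilon> t * (2 + \<epsilon> t + \<mu> / real t) + 44 * sqrt (2 * \<mu>) * real t powr (\<beta> - 1 / 2) * \<epsilon> t
          + sqrt (2 / pi) * (\<epsilon> t + \<mu> * real t powr (\<beta> - 1) * \<epsilon> t)"
      using r s by simp
    also have "\<dots> = ?q t * \<epsilon> t" by (simp only: ring_distribs ac_simps)
    also have "\<dots> \<le> C * \<epsilon> t" using elim \<epsilon>0 by (intro mult_right_mono) auto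
    finally show ?case using elim by simp
  qed
qed

lemma integrable_centred_moment:
  fixes p :: "nat pmf" and \<alpha> m :: real
  assumes "1 < \<alpha>" "\<alpha> \<le> 2" "integrable p (\<lambda>\<tau>. real \<tau> powr \<alpha>)"
  shows "integrable p real" "integrable p (\<lambda>\<tau>. \<bar>real \<tau> - m\<bar> powr \<alpha>)"
proof -
  have "real \<tau> \<le> real \<tau> powr \<alpha>" for \<tau> :: nat
    using powr_mono[of 1 \<alpha> "real \<tau>"] assms(1) by (cases "\<tau> = 0") auto
  thus int: "integrable p real"
    by (intro Bochner_Integration.integrable_bound[OF assms(3)] AE_I2) auto
  \<comment> \<open>\<open>abs_powr_add_le\<close> with \<open>- m\<close> as the fixed summand
    provides an integrable majorant.\<close>
  let ?d = "\<alpha> * (sgn (- m) * \<bar>- m\<bar> powr (\<alpha> - 1))"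
  have "integrable p (\<lambda>\<tau>. \<bar>- m\<bar> powr \<alpha> + ?d * real \<tau> + 4 * real \<tau> powr \<alpha>)"
    using int assms(3) by auto
  thus "integrable p (\<lambda>\<tau>. \<bar>real \<tau> - m\<bar> powr \<alpha>)"
  proof (rule Bochner_Integration.integrable_bound)
    have "\<bar>real \<tau> - m\<bar> powr \<alpha> \<le> \<bar>- m\<bar> powr \<alpha> + ?d * real \<tau> + 4 * real \<tau> powr \<alpha>" for \<tau> :: nat
      using abs_powr_add_le[OF assms(1,2), of "- m" "real \<tau>"] by (simp add: add.commute[of "- m"])
    thus "AE \<tau> in p. norm (\<bar>real \<tau> - m\<bar> powr \<alpha>) \<le> norm (\<bar>- m\<bar> powr \<alpha> + ?d * real \<tau> + 4 * real \<tau> powr \<alpha>)"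
      by (intro AE_I2) (smt (verit) powr_ge_zero real_norm_def)
  qed simp
qed

lemma distr_eq_measure_pmf:
  fixes T :: "'b \<Rightarrow> nat"
  assumes "prob_space N" "T \<in> measurable N (count_space UNIV)" "\<And>\<tau>. \<P>(\<omega> in N. T \<omega> = \<tau>) = pmf p \<tau>"
  shows "distr N (count_space UNIV) T = measure_pmf p"
proof (rule measure_eqI_countable[of _ UNIV])
  interpret prob_space N by fact
  fix \<tau> :: nat
  have "T -` {\<tau>} \<inter> space N = {\<omega> \<in> space N. T \<omega> = \<tau>}" by auto
  thus "emeasure (distr N (count_space UNIV) T) {\<tau>} = emeasure p {\<tau>}"
    using assms(2,3) by (simp add: emeasure_distr emeasure_eq_measure emeasure_pmf_single)
qed auto

theorem theorem2:
  fixes p :: "nat pmf"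
    and N :: "'b measure" and T :: "'b \<Rightarrow> nat"
    and M :: "'a measure" and X :: "nat \<Rightarrow> 'a \<Rightarrow> int" and R :: "nat \<Rightarrow> 'a \<Rightarrow> nat"
    and \<alpha> C C\<^sub>T \<mu> :: real
  assumes "prob_space N"
    and "T \<in> measurable N (count_space UNIV)"
    and "\<And>\<tau>. \<P>(\<omega> in N. T \<omega> = \<tau>) = pmf p \<tau>"
    and "trapped_random_walk M p X R"
    and "started_at_origin M p X R"
    and "1 < \<alpha>" and "\<alpha> \<le> 2"
    and "integrable N (\<lambda>\<omega>. real (T \<omega>) powr \<alpha>)"
    and "C\<^sub>T = (LINT \<omega>|N. \<bar>real (T \<omega>) - (LINT \<omega>'|N. real (T \<omega>'))\<bar> powr \<alpha>)"
    and "\<mu> = (LINT \<omega>|N. real (T \<omega>)) + 1"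
    and "C > 8 * C\<^sub>T / \<mu> + sqrt (2 * \<mu> / pi)"
  shows "\<exists>t_star::nat. t_star \<ge> 1 \<and>
    (\<forall>I::real set. is_interval I \<longrightarrow> bounded I \<longrightarrow> (\<forall>t::nat. t \<ge> t_star \<longrightarrow>
      \<bar>\<P>(\<omega> in M. real_of_int (X t \<omega>) \<in> (\<lambda>x. sqrt (real t / \<mu>) * x) ` I)
        - 1 / sqrt (2 * pi) * (LINT x:I|lborel. exp (- x\<^sup>2 / 2))\<bar>
      \<le> C * real t powr ((1 - \<alpha>) / (1 + \<alpha>))))"
proof -
  note T = assms(2)
  note law = distr_eq_measure_pmf[OF assms(1-3)]
  define m where "m = measure_pmf.expectation p real"
  define c where "c = measure_pmf.expectation p (\<lambda>\<tau>. \<bar>real \<tau> - m\<bar> powr \<alpha>)"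
  have transfer: "(LINT \<omega>|N. f (T \<omega>)) = measure_pmf.expectation p f" for f :: "nat \<Rightarrow> real"
    unfolding law [symmetric] by (rule integral_distr [symmetric, OF T]) simp
  have \<mu>: "\<mu> = m + 1" unfolding assms(10) transfer m_def ..
  have C\<^sub>T: "C\<^sub>T = c" unfolding assms(9) transfer m_def [symmetric] c_def by (rule transfer)
  have "integrable p (\<lambda>\<tau>. real \<tau> powr \<alpha>)"
    using assms(8) unfolding law [symmetric] by (subst integrable_distr_eq[OF T]) simp_all
  note int = integrable_centred_moment[OF assms(6,7) this]
  have "m \<ge> 0" by (simp add: m_def)
  hence "\<mu> \<ge> 1" by (simp add: \<mu>)
  \<comment> \<open>The estimates produce \<open>sqrt (2 / pi)\<close>; \<mu> \<ge> 1 bounds it by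
    the constant in the hypothesis on \<open>C\<close>.\<close>
  hence "sqrt (2 / pi) \<le> sqrt (2 * \<mu> / pi)" by (intro real_sqrt_le_mono divide_right_mono) auto
  hence "C > 8 * c / \<mu> + sqrt (2 / pi)" using assms(11) unfolding C\<^sub>T by linarith
  then obtain t0 where t0: "\<And>t. t \<ge> t0 \<Longrightarrow>
      real t powr ((1 - \<alpha>) / (1 + \<alpha>)) + \<mu> / real t \<le> 1 / 2 \<and>
      4 * c / \<mu> * real t powr ((1 - \<alpha>) / (1 + \<alpha>)) * (2 + real t powr ((1 - \<alpha>) / (1 + \<alpha>)) + \<mu> / real t)
        + 44 / sqrt (real t / (2 * \<mu>)) + sqrt (2 / pi) * (real t powr ((1 - \<alpha>) / (1 + \<alpha>)) + \<mu> / real t)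
      \<le> C * real t powr ((1 - \<alpha>) / (1 + \<alpha>))"
    using error_eventually_le[OF assms(6,7), of \<mu> c C] \<open>\<mu> \<ge> 1\<close>
    unfolding eventually_sequentially by auto
  show ?thesis
  proof (intro exI[of _ "max 1 t0"] conjI allI impI)
    fix I :: "real set" and t :: nat
    assume I: "is_interval I" "bounded I" and "t \<ge> max 1 t0"
    hence t: "t > 0" "t \<ge> t0" by auto
    have density: "std_normal_density = (\<lambda>x. 1 / sqrt (2 * pi) * exp (- x\<^sup>2 / 2))"
      by (rule ext) (rule std_normal_density_def)
    have "1 / sqrt (2 * pi) * (LINT x:I|lborel. exp (- x\<^sup>2 / 2)) = measure std_normal_distribution I"
      unfolding measure_std_normal[OF real_interval_borel_measurable[OF I(1)]]
      unfolding density by (rule set_integral_mult_right [symmetric])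
    moreover have "\<P>(\<omega> in M. real_of_int (X t \<omega>) \<in> (\<lambda>x. sqrt (real t / \<mu>) * x) ` I)
        = measure_pmf.expectation (jump_count p t)
            (\<lambda>k. measure_pmf.prob (srw k 0) {s. of_int s \<in> (\<lambda>x. sqrt (real t / \<mu>) * x) ` I})"
      using trapped_walk_position_prob[OF assms(4,5), of t "{s. of_int s \<in> (\<lambda>x. sqrt (real t / \<mu>) * x) ` I}"]
      by simp
    moreover note order_trans[OF trapped_walk_interval_bound[OF assms(6,7) int(1) m_def int(2) t(1) _ I,
          folded \<mu> c_def, OF conjunct1[OF t0[OF t(2)]]] conjunct2[OF t0[OF t(2)]]]
    ultimately show "\<bar>\<P>(\<omega> in M. real_of_int (X t \<omega>) \<in> (\<lambda>x. sqrt (real t / \<mu>) * x) ` I)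
        - 1 / sqrt (2 * pi) * (LINT x:I|lborel. exp (- x\<^sup>2 / 2))\<bar> \<le> C * real t powr ((1 - \<alpha>) / (1 + \<alpha>))"
      by (simp only:)
  qed simp
qed

end
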